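(* Let $k\ge1$ be an integer, and let $\varphi:(M,g)\to(N_1,h_1)$ and $\psi:(M,g)\to(N_2,h_2)$ be two smooth maps between Riemannian manifolds. Then the map $\phi:(M,g)\to(N_1\times N_2,h_1\times h_2)$, $\phi(x)=(\varphi(x),\psi(x))$, is $k$-harmonic if and only if both maps $\varphi$ and $\psi$ are $k$-harmonic. Furthermore, if one of $\varphi$ and $\psi$ is harmonic and the other is a proper $k$-harmonic map, then $\phi$ is a proper $k$-harmonic map.
   Context: $h_1\times h_2$ is the product Riemannian metric. For a smooth map $\phi:(M,g)\to(N,h)$, let $\{e_i\}$ be a local orthonormal frame on $M$, $\nabla,\nabla^N$ the Levi-Civita connections of $M$ and $N$, and $\overline\nabla$ the induced connection on $\phi^{-1}TN$. Curvature convention: $R^N(X,Y)=\nabla^N_X\nabla^N_Y-\nabla^N_Y\nabla^N_X-\nabla^N_{[X,Y]}$. The tension field is $\tau(\phi)=\sum_i\big(\overline\nabla_{e_i}d\phi(e_i)-d\phi(\nabla_{e_i}e_i)\big)$; $\phi$ is harmonic if $\tau(\phi)=0$. The rough Laplacian on $\Gamma(\phi^{-1}TN)$ is $\overline\Delta=-\sum_i(\overline\nabla_{e_i}\overline\nabla_{e_i}-\overline\nabla_{\nabla_{e_i}e_i})$, with iterates $\overline\Delta^{j}$, and $\mathscr R(V)=\sum_iR^N(V,d\phi(e_i))d\phi(e_i)$. For $k\ge2$, $\phi$ is called $k$-harmonic if $\tau_k(\phi):=\overline\Delta^{k-1}\tau(\phi)-\mathscr R\big(\overline\Delta^{k-2}\tau(\phi)\big)=0$;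 $1$-harmonic means harmonic. A $k$-harmonic map is proper if it is not harmonic. *)

theory Defs
  imports "HOL-Analysis.Analysis"
begin

section \<open>Smooth functions between Euclidean spaces\<close>

text \<open>\<open>Ck_on n S f\<close>: all iterated directional derivatives of \<open>f\<close> of order at most \<open>n\<close>
  exist (as Frechet derivatives up to order \<open>n\<close>) and are continuous on \<open>S\<close>. The set \<open>S\<close> is
  meant to be open.\<close>

primrec Ck_on :: "nat \<Rightarrow> 'a::real_normed_vector set \<Rightarrow> ('a \<Rightarrow> 'b::real_normed_vector) \<Rightarrow> bool" where
  "Ck_on 0 S f \<longleftrightarrow> continuous_on S f"
| "Ck_on (Suc n) S f \<longleftrightarrow> (\<forall>x\<in>S. f differentiable (at x)) \<and>
     (\<forall>v. Ck_on n S (\<lambda>x. frechet_derivative f (at x) v))"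

definition smooth_on :: "'a::real_normed_vector set \<Rightarrow> ('a \<Rightarrow> 'b::real_normed_vector) \<Rightarrow> bool" where
  "smooth_on S f \<longleftrightarrow> (\<forall>n. Ck_on n S f)"

section \<open>Riemannian manifolds\<close>

text \<open>A manifold of dimension \<open>DIM('m)\<close> is a topological space with an indexed smooth atlas
  \<open>(dom i, chart i)\<close>, \<open>i \<in> idx\<close>, which need not be maximal. The metric is given by its
  representation in each chart: \<open>metric i x u v\<close> is the inner product of the tangent vectors at
  the point with coordinates \<open>x\<close> whose components in chart \<open>i\<close> are \<open>u\<close> and \<open>v\<close>.\<close>

record ('a, 'i, 'm) rmanifold =
  mtop :: "'a topology"
  idx :: "'i set"
  dom :: "'i \<Rightarrow> 'a set"
  chart :: "'i \<Rightarrow> 'a \<Rightarrow> 'm"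
  metric :: "'i \<Rightarrow> 'm \<Rightarrow> 'm \<Rightarrow> 'm \<Rightarrow> real"

definition chart_inv :: "('a, 'i, 'm) rmanifold \<Rightarrow> 'i \<Rightarrow> 'm \<Rightarrow> 'a" where
  "chart_inv M i = inv_into (dom M i) (chart M i)"

definition transition :: "('a, 'i, 'm) rmanifold \<Rightarrow> 'i \<Rightarrow> 'i \<Rightarrow> 'm \<Rightarrow> 'm" where
  "transition M i j = chart M j \<circ> chart_inv M i"

definition smooth_manifold :: "('a, 'i, 'm::euclidean_space) rmanifold \<Rightarrow> bool" where
  "smooth_manifold M \<longleftrightarrow>
     Hausdorff_space (mtop M) \<and> second_countable (mtop M) \<and>
     topspace (mtop M) = (\<Union>i\<in>idx M. dom M i) \<and>
     (\<forall>i\<in>idx M. openin (mtop M) (dom M i) \<and> open (chart M i ` dom M i) \<and>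
        homeomorphic_map (subtopology (mtop M) (dom M i))
          (top_of_set (chart M i ` dom M i)) (chart M i)) \<and>
     (\<forall>i\<in>idx M. \<forall>j\<in>idx M. smooth_on (chart M i ` (dom M i \<inter> dom M j)) (transition M i j))"

definition inner_product :: "('m::real_vector \<Rightarrow> 'm \<Rightarrow> real) \<Rightarrow> bool" where
  "inner_product B \<longleftrightarrow> bilinear B \<and> (\<forall>u v. B u v = B v u) \<and> (\<forall>u. u \<noteq> 0 \<longrightarrow> B u u > 0)"

definition riemannian_manifold :: "('a, 'i, 'm::euclidean_space) rmanifold \<Rightarrow> bool" where
  "riemannian_manifold M \<longleftrightarrow> smooth_manifold M \<and>
     (\<forall>i\<in>idx M. (\<forall>x\<in>chart M i ` dom M i. inner_product (metric M i x)) \<and>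
        (\<forall>u v. smooth_on (chart M i ` dom M i) (\<lambda>x. metric M i x u v))) \<and>
     (\<forall>i\<in>idx M. \<forall>j\<in>idx M. \<forall>x\<in>chart M i ` (dom M i \<inter> dom M j). \<forall>u v.
        metric M i x u v =
          metric M j (transition M i j x)
            (frechet_derivative (transition M i j) (at x) u)
            (frechet_derivative (transition M i j) (at x) v))"

definition product_manifold ::
  "('a, 'i, 'm::euclidean_space) rmanifold \<Rightarrow> ('b, 'j, 'n::euclidean_space) rmanifold
    \<Rightarrow> ('a \<times> 'b, 'i \<times> 'j, 'm \<times> 'n) rmanifold" where
  "product_manifold M N = \<lparr>
     mtop = prod_topology (mtop M) (mtop N),
     idx = idx M \<times> idx N,
     dom = (\<lambda>(i, j). dom M i \<times> dom N j),
     chart = (\<lambda>(i, j) (p, q). (chart M i p, chart N j q)),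
     metric = (\<lambda>(i, j) (x, y) (u, u') (v, v'). metric M i x u v + metric N j y u' v') \<rparr>"

definition local_rep :: "('a, 'i, 'm) rmanifold \<Rightarrow> ('b, 'j, 'n) rmanifold
    \<Rightarrow> ('a \<Rightarrow> 'b) \<Rightarrow> 'i \<Rightarrow> 'j \<Rightarrow> 'm \<Rightarrow> 'n" where
  "local_rep M N \<phi> i j = chart N j \<circ> \<phi> \<circ> chart_inv M i"

definition smooth_map :: "('a, 'i, 'm::euclidean_space) rmanifold
    \<Rightarrow> ('b, 'j, 'n::euclidean_space) rmanifold \<Rightarrow> ('a \<Rightarrow> 'b) \<Rightarrow> bool" where
  "smooth_map M N \<phi> \<longleftrightarrow> continuous_map (mtop M) (mtop N) \<phi> \<and>
     (\<forall>i\<in>idx M. \<forall>j\<in>idx N.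
        smooth_on (chart M i ` {p \<in> dom M i. \<phi> p \<in> dom N j}) (local_rep M N \<phi> i j))"

section \<open>Connections and curvature in a chart\<close>

text \<open>Throughout this section a vector field on a chart, or along the local representative \<open>f\<close> of
  a map, is given by its component function. All expressions evaluated at \<open>x\<close> depend only on the
  germs at \<open>x\<close> of the functions involved, so these may be arbitrary away from their domains.\<close>

definition dirderiv :: "('m::real_normed_vector \<Rightarrow> 'm) \<Rightarrow> ('m \<Rightarrow> 'n::real_normed_vector) \<Rightarrow> 'm \<Rightarrow> 'n" where
  "dirderiv X V = (\<lambda>x. frechet_derivative V (at x) (X x))"

text \<open>A connection on a chart has the form \<open>\<nabla>\<^sub>X Y = D\<^sub>X Y + \<Gamma>(X, Y)\<close> with \<open>\<Gamma> x\<close> bilinear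
  (in components, \<open>\<Gamma> x u v = \<Gamma>\<^sup>c\<^sub>a\<^sub>b(x) u\<^sup>a v\<^sup>b\<close>). Torsion-freeness means that \<open>\<Gamma> x\<close> is
  symmetric, and the third condition is compatibility with the metric. For a Riemannian metric
  there is exactly one such \<open>\<Gamma> x\<close>, whose components are the Christoffel symbols.\<close>

definition is_levi_civita_at ::
  "('m::euclidean_space \<Rightarrow> 'm \<Rightarrow> 'm \<Rightarrow> real) \<Rightarrow> 'm \<Rightarrow> ('m \<Rightarrow> 'm \<Rightarrow> 'm) \<Rightarrow> bool" where
  "is_levi_civita_at g x \<Gamma> \<longleftrightarrow> bilinear \<Gamma> \<and> (\<forall>u v. \<Gamma> u v = \<Gamma> v u) \<and>
     (\<forall>u v w. frechet_derivative (\<lambda>y. g y v w) (at x) u = g x (\<Gamma> u v) w + g x v (\<Gamma> u w))"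

definition christoffel :: "('m::euclidean_space \<Rightarrow> 'm \<Rightarrow> 'm \<Rightarrow> real) \<Rightarrow> 'm \<Rightarrow> 'm \<Rightarrow> 'm \<Rightarrow> 'm" where
  "christoffel g x = (THE \<Gamma>. is_levi_civita_at g x \<Gamma>)"

definition nabla :: "('m::euclidean_space \<Rightarrow> 'm \<Rightarrow> 'm \<Rightarrow> real) \<Rightarrow> ('m \<Rightarrow> 'm) \<Rightarrow> ('m \<Rightarrow> 'm) \<Rightarrow> 'm \<Rightarrow> 'm" where
  "nabla g X Y = (\<lambda>x. dirderiv X Y x + christoffel g x (X x) (Y x))"

definition lie_bracket :: "('m::real_normed_vector \<Rightarrow> 'm) \<Rightarrow> ('m \<Rightarrow> 'm) \<Rightarrow> 'm \<Rightarrow> 'm" where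
  "lie_bracket X Y = (\<lambda>x. dirderiv X Y x - dirderiv Y X x)"

definition curvature_field :: "('m::euclidean_space \<Rightarrow> 'm \<Rightarrow> 'm \<Rightarrow> real)
    \<Rightarrow> ('m \<Rightarrow> 'm) \<Rightarrow> ('m \<Rightarrow> 'm) \<Rightarrow> ('m \<Rightarrow> 'm) \<Rightarrow> 'm \<Rightarrow> 'm" where
  "curvature_field g X Y Z = (\<lambda>x. nabla g X (nabla g Y Z) x - nabla g Y (nabla g X Z) x
     - nabla g (lie_bracket X Y) Z x)"

text \<open>Since the curvature is tensorial, its value on tangent vectors at \<open>x\<close> is computed from any
  extension to vector fields; here the one with constant components.\<close>

definition curvature :: "('m::euclidean_space \<Rightarrow> 'm \<Rightarrow> 'm \<Rightarrow> real)
    \<Rightarrow> 'm \<Rightarrow> 'm \<Rightarrow> 'm \<Rightarrow> 'm \<Rightarrow> 'm" where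
  "curvature g x u v w = curvature_field g (\<lambda>_. u) (\<lambda>_. v) (\<lambda>_. w) x"

text \<open>\<open>\<nabla>\<close>-bar: the connection on the pullback of the tangent bundle of the target (with metric
  \<open>h\<close>) induced along \<open>f\<close>.\<close>

definition nabla_pullback :: "('n::euclidean_space \<Rightarrow> 'n \<Rightarrow> 'n \<Rightarrow> real)
    \<Rightarrow> ('m::euclidean_space \<Rightarrow> 'n) \<Rightarrow> ('m \<Rightarrow> 'm) \<Rightarrow> ('m \<Rightarrow> 'n) \<Rightarrow> 'm \<Rightarrow> 'n" where
  "nabla_pullback h f X V =
     (\<lambda>x. dirderiv X V x + christoffel h (f x) (dirderiv X f x) (V x))"

section \<open>\<open>k\<close>-tension fields in charts, with respect to a local orthonormal frame\<close>

text \<open>The frame is \<open>e 0, \<dots>, e (DIM('m) - 1)\<close>. Note that \<open>dirderiv X f\<close> is \<open>df(X)\<close>.\<close>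

definition orthonormal_frame_on ::
  "('m::euclidean_space \<Rightarrow> 'm \<Rightarrow> 'm \<Rightarrow> real) \<Rightarrow> 'm set \<Rightarrow> (nat \<Rightarrow> 'm \<Rightarrow> 'm) \<Rightarrow> bool" where
  "orthonormal_frame_on g V e \<longleftrightarrow> (\<forall>a<DIM('m). smooth_on V (e a)) \<and>
     (\<forall>x\<in>V. \<forall>a<DIM('m). \<forall>b<DIM('m). g x (e a x) (e b x) = (if a = b then 1 else 0))"

definition tension ::
  "('m::euclidean_space \<Rightarrow> 'm \<Rightarrow> 'm \<Rightarrow> real) \<Rightarrow> ('n::euclidean_space \<Rightarrow> 'n \<Rightarrow> 'n \<Rightarrow> real)
    \<Rightarrow> (nat \<Rightarrow> 'm \<Rightarrow> 'm) \<Rightarrow> ('m \<Rightarrow> 'n) \<Rightarrow> 'm \<Rightarrow> 'n" where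
  "tension g h e f = (\<lambda>x. \<Sum>a<DIM('m).
     nabla_pullback h f (e a) (dirderiv (e a) f) x - dirderiv (nabla g (e a) (e a)) f x)"

definition rough_laplacian ::
  "('m::euclidean_space \<Rightarrow> 'm \<Rightarrow> 'm \<Rightarrow> real) \<Rightarrow> ('n::euclidean_space \<Rightarrow> 'n \<Rightarrow> 'n \<Rightarrow> real)
    \<Rightarrow> (nat \<Rightarrow> 'm \<Rightarrow> 'm) \<Rightarrow> ('m \<Rightarrow> 'n) \<Rightarrow> ('m \<Rightarrow> 'n) \<Rightarrow> 'm \<Rightarrow> 'n" where
  "rough_laplacian g h e f V = (\<lambda>x. - (\<Sum>a<DIM('m).
     nabla_pullback h f (e a) (nabla_pullback h f (e a) V) x
     - nabla_pullback h f (nabla g (e a) (e a)) V x))"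

definition curvature_trace ::
  "('n::euclidean_space \<Rightarrow> 'n \<Rightarrow> 'n \<Rightarrow> real) \<Rightarrow> (nat \<Rightarrow> 'm \<Rightarrow> 'm) \<Rightarrow> ('m::euclidean_space \<Rightarrow> 'n)
    \<Rightarrow> ('m \<Rightarrow> 'n) \<Rightarrow> 'm \<Rightarrow> 'n" where
  "curvature_trace h e f V = (\<lambda>x. \<Sum>a<DIM('m).
     curvature h (f x) (V x) (dirderiv (e a) f x) (dirderiv (e a) f x))"

definition k_tension ::
  "nat \<Rightarrow> ('m::euclidean_space \<Rightarrow> 'm \<Rightarrow> 'm \<Rightarrow> real) \<Rightarrow> ('n::euclidean_space \<Rightarrow> 'n \<Rightarrow> 'n \<Rightarrow> real)
    \<Rightarrow> (nat \<Rightarrow> 'm \<Rightarrow> 'm) \<Rightarrow> ('m \<Rightarrow> 'n) \<Rightarrow> 'm \<Rightarrow> 'n" where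
  "k_tension k g h e f =
     (if k \<le> 1 then tension g h e f
      else (\<lambda>x. (rough_laplacian g h e f ^^ (k - 1)) (tension g h e f) x
        - curvature_trace h e f ((rough_laplacian g h e f ^^ (k - 2)) (tension g h e f)) x))"

section \<open>\<open>k\<close>-harmonic maps\<close>

text \<open>The \<open>k\<close>-tension field vanishes at each point, in all charts of the two atlases and with
  respect to all local orthonormal frames around the point. (Such frames exist by Gram-Schmidt, and
  the vanishing does not depend on the choice of charts and frame.)\<close>

definition k_harmonic :: "nat \<Rightarrow> ('a, 'i, 'm::euclidean_space) rmanifold
    \<Rightarrow> ('b, 'j, 'n::euclidean_space) rmanifold \<Rightarrow> ('a \<Rightarrow> 'b) \<Rightarrow> bool" where
  "k_harmonic k M N \<phi> \<longleftrightarrow> smooth_map M N \<phi> \<and>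
     (\<forall>p\<in>topspace (mtop M). \<forall>i\<in>idx M. \<forall>j\<in>idx N. p \<in> dom M i \<and> \<phi> p \<in> dom N j \<longrightarrow>
        (\<forall>V e. open V \<and> chart M i p \<in> V \<and> V \<subseteq> chart M i ` dom M i \<and>
           orthonormal_frame_on (metric M i) V e \<longrightarrow>
           k_tension k (metric M i) (metric N j) e (local_rep M N \<phi> i j) (chart M i p) = 0))"

abbreviation harmonic :: "('a, 'i, 'm::euclidean_space) rmanifold
    \<Rightarrow> ('b, 'j, 'n::euclidean_space) rmanifold \<Rightarrow> ('a \<Rightarrow> 'b) \<Rightarrow> bool" where
  "harmonic \<equiv> k_harmonic 1"

definition proper_k_harmonic :: "nat \<Rightarrow> ('a, 'i, 'm::euclidean_space) rmanifold
    \<Rightarrow> ('b, 'j, 'n::euclidean_space) rmanifold \<Rightarrow> ('a \<Rightarrow> 'b) \<Rightarrow> bool" where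
  "proper_k_harmonic k M N \<phi> \<longleftrightarrow> k_harmonic k M N \<phi> \<and> \<not> harmonic M N \<phi>"

end

theory Submission
  imports Defs
begin

text \<open>The Levi-Civita connection and the curvature of a product metric split into those of the
  factors, so in product charts the \<open>k\<close>-tension field of \<open>(\<phi>, \<psi>)\<close> is the pair of the
  \<open>k\<close>-tension fields of \<open>\<phi>\<close> and \<open>\<psi>\<close>; it vanishes iff both do. Since \<open>frechet_derivative\<close> is
  arbitrary at points of non-differentiability, this splitting is only valid where all fields
  involved are smooth, and in particular requires that the Christoffel symbols, determined by the
  Koszul formula, are smooth. The second claim follows because the iterated rough Laplacians and the
  curvature term of a tension field that vanishes on an open set vanish there.\<close>

section \<open>Calculus of smooth functions\<close>

text \<open>Every expression at a point depends on germs only, so the identities are proved on an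
  open set \<open>W\<close> of coordinates whose points are sent into one fixed chart of each
  target. They are needed at all points of \<open>W\<close> at once, because each further Laplacian
  differentiates the previous field. Only the target is a product: the domain metric and the frame
  are common to both maps, and no frame on the product is ever chosen. The obstacle is
  \<open>christoffel\<close>, a definite description that says nothing until existence and
  uniqueness are known. Both come from reading the Koszul formula as an equation g(C, w) = K(w) for
  a vector C. It is solved smoothly in the base point by adding one basis vector at a time and
  dividing only by positive functions g(N, N), so that no Gram matrix is inverted. Uniqueness then
  also identifies the symbols of the product: the pair of symbols of the factors satisfies its
  Koszul formula.\<close>

text \<open>\<open>frechet_derivative\<close> chooses from the set of all derivatives at the point.
  Functions that agree near the point have the same set, hence the same choice, even where that set
  is empty.\<close>

lemma frechet_derivative_cong_open:
  assumes "open S" "x \<in> S" "\<And>y. y \<in> S \<Longrightarrow> f y = g y"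
  shows "frechet_derivative f (at x) = frechet_derivative g (at x)"
proof -
  have "(f has_derivative D) (at x) \<longleftrightarrow> (g has_derivative D) (at x)" for D
    using assms by (metis has_derivative_transform_within_open)
  then show ?thesis
    unfolding frechet_derivative_def by simp
qed

lemma has_derivative_frechet_derivative:
  "f differentiable (at x) \<Longrightarrow> (f has_derivative frechet_derivative f (at x)) (at x)"
  using frechet_derivative_works by blast

lemma Ck_on_cong:
  assumes "open S" "\<And>x. x \<in> S \<Longrightarrow> f x = g x"
  shows "Ck_on n S f \<longleftrightarrow> Ck_on n S g"
  using assms(2)
proof (induction n arbitrary: f g)
  case 0
  then show ?case
    using continuous_on_cong[of S S f g] by simp
next
  case (Suc n)
  have "f differentiable at x \<longleftrightarrow> g differentiable at x" if "x \<in> S" for x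
    using assms(1) Suc.prems that unfolding differentiable_def
    by (metis has_derivative_transform_within_open)
  moreover have "Ck_on n S (\<lambda>x. frechet_derivative f (at x) v) \<longleftrightarrow>
      Ck_on n S (\<lambda>x. frechet_derivative g (at x) v)" for v
    using frechet_derivative_cong_open[OF assms(1) _ Suc.prems] by (intro Suc.IH) simp
  ultimately show ?case by simp
qed

lemma Ck_on_subset: "Ck_on n S f \<Longrightarrow> T \<subseteq> S \<Longrightarrow> Ck_on n T f"
  by (induction n arbitrary: f) (auto intro: continuous_on_subset)

lemma Ck_on_SucD:
  assumes "Ck_on (Suc n) S f"
  shows "x \<in> S \<Longrightarrow> (f has_derivative frechet_derivative f (at x)) (at x)"
    and "Ck_on n S (\<lambda>x. frechet_derivative f (at x) v)"
  using assms by (auto intro: has_derivative_frechet_derivative)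

lemma Ck_on_Suc_imp: "Ck_on (Suc n) S f \<Longrightarrow> Ck_on n S f"
proof (induction n arbitrary: f)
  case 0
  then show ?case
    by (auto simp: differentiable_imp_continuous_within continuous_at_imp_continuous_on)
next
  case (Suc n)
  have "Ck_on n S (\<lambda>x. frechet_derivative f (at x) v)" for v
    by (rule Suc.IH[OF Ck_on_SucD(2)[OF Suc.prems]])
  with Suc.prems show ?case by simp
qed

text \<open>Derivatives are unique, so the closure proofs below can work with the explicit
  \<open>f'\<close> that the sum, product or chain rule delivers.\<close>

lemma Ck_on_SucI:
  assumes "open S" "\<And>x. x \<in> S \<Longrightarrow> (f has_derivative f' x) (at x)"
    and "\<And>v. Ck_on n S (\<lambda>x. f' x v)"
  shows "Ck_on (Suc n) S f"
proof -
  have "Ck_on n S (\<lambda>x. frechet_derivative f (at x) v)" for v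
    using frechet_derivative_at[OF assms(2)]
    by (intro Ck_on_cong[OF assms(1), THEN iffD1, OF _ assms(3)]) simp
  then show ?thesis
    using assms(2) by (auto simp: differentiable_def)
qed

lemma Ck_on_const: "open S \<Longrightarrow> Ck_on n S (\<lambda>x. c)"
proof (induction n arbitrary: c)
  case (Suc n)
  show ?case
    by (rule Ck_on_SucI[OF Suc.prems, where f' = "\<lambda>x v. 0"]) (auto intro: Suc)
qed simp

lemma Ck_on_add: "open S \<Longrightarrow> Ck_on n S f \<Longrightarrow> Ck_on n S g \<Longrightarrow> Ck_on n S (\<lambda>x. f x + g x)"
proof (induction n arbitrary: f g)
  case 0
  then show ?case by (simp add: continuous_on_add continuous_on_inverse)
next
  case (Suc n)
  note f = Ck_on_SucD[OF Suc.prems(2)] and g = Ck_on_SucD[OF Suc.prems(3)]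
  show ?case
    by (rule Ck_on_SucI[OF Suc.prems(1) has_derivative_add[OF f(1) g(1)]])
      (assumption, assumption, intro Suc.IH Suc.prems(1) f(2) g(2))
qed

lemma (in bounded_linear) Ck_on: "open S \<Longrightarrow> Ck_on n S g \<Longrightarrow> Ck_on n S (\<lambda>x. f (g x))"
proof (induction n arbitrary: g)
  case 0
  then show ?case by (simp add: continuous_on)
next
  case (Suc n)
  note g = Ck_on_SucD[OF Suc.prems(2)]
  show ?case
    by (rule Ck_on_SucI[OF Suc.prems(1) has_derivative[OF g(1)]])
      (assumption, intro Suc.IH Suc.prems(1) g(2))
qed

text \<open>The Leibniz rule also contains the undifferentiated factors; they enter the induction
  hypothesis at order \<open>n\<close> through \<open>Ck_on_Suc_imp\<close>.\<close>

lemma (in bounded_bilinear) Ck_on: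
  "open S \<Longrightarrow> Ck_on n S f \<Longrightarrow> Ck_on n S g \<Longrightarrow> Ck_on n S (\<lambda>x. prod (f x) (g x))"
proof (induction n arbitrary: f g)
  case 0
  then show ?case by (simp add: continuous_on)
next
  case (Suc n)
  note f = Ck_on_SucD[OF Suc.prems(2)] and g = Ck_on_SucD[OF Suc.prems(3)]
  show ?case
    by (rule Ck_on_SucI[OF Suc.prems(1) FDERIV[OF f(1) g(1)]])
      (assumption, assumption, intro Ck_on_add Suc.IH Suc.prems(1) f(2) g(2)
        Ck_on_Suc_imp[OF Suc.prems(2)] Ck_on_Suc_imp[OF Suc.prems(3)])
qed

lemma Ck_on_inverse:
  fixes f :: "'a::real_normed_vector \<Rightarrow> real"
  shows "open S \<Longrightarrow> Ck_on n S f \<Longrightarrow> (\<And>x. x \<in> S \<Longrightarrow> f x \<noteq> 0) \<Longrightarrow> Ck_on n S (\<lambda>x. inverse (f x))"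
proof (induction n)
  case 0
  then show ?case by (simp add: continuous_on_add continuous_on_inverse)
next
  case (Suc n)
  note f = Ck_on_SucD[OF Suc.prems(2)]
  have inv: "Ck_on n S (\<lambda>x. inverse (f x))"
    using Suc Ck_on_Suc_imp by blast
  have "Ck_on n S (\<lambda>x. - (inverse (f x) * frechet_derivative f (at x) v * inverse (f x)))" for v
    by (intro bounded_linear.Ck_on[OF bounded_linear_minus[OF bounded_linear_ident]]
        bounded_bilinear.Ck_on[OF bounded_bilinear_mult] inv f(2) Suc.prems(1))
  with Deriv.has_derivative_inverse[OF Suc.prems(3) f(1)] show ?case
    by (intro Ck_on_SucI[OF Suc.prems(1)])
qed

text \<open>\<open>Ck_on\<close> controls derivatives in fixed directions only. This expansion turns
  a derivative in a direction that varies with the point into a finite sum of scalar coefficients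
  times derivatives in fixed directions.\<close>

lemma bounded_linear_eq_sum_Basis:
  fixes L :: "'a::euclidean_space \<Rightarrow> 'b::real_normed_vector"
  assumes "bounded_linear L"
  shows "L v = (\<Sum>b\<in>Basis. (v \<bullet> b) *\<^sub>R L b)"
proof -
  have "L v = L (\<Sum>b\<in>Basis. (v \<bullet> b) *\<^sub>R b)"
    by (simp add: euclidean_representation)
  also have "\<dots> = (\<Sum>b\<in>Basis. (v \<bullet> b) *\<^sub>R L b)"
    using assms by (simp add: bounded_linear.linear linear_sum linear_cmul)
  finally show ?thesis .
qed

lemma Ck_on_sum:
  "open S \<Longrightarrow> (\<And>i. i \<in> I \<Longrightarrow> Ck_on n S (f i)) \<Longrightarrow> Ck_on n S (\<lambda>x. \<Sum>i\<in>I. f i x)"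
  by (induction I rule: infinite_finite_induct) (simp_all add: Ck_on_const Ck_on_add)

text \<open>The chain rule differentiates \<open>g\<close> in the moving direction
  \<open>frechet_derivative f (at x) v\<close>. After expansion in \<open>Basis\<close>, each term
  is a coordinate of that direction times a derivative of \<open>g\<close> along a fixed
  \<open>b\<close>, composed with \<open>f\<close>; the induction hypothesis for arbitrary
  \<open>g\<close> covers the latter.\<close>

lemma Ck_on_compose:
  fixes f :: "'a::real_normed_vector \<Rightarrow> 'b::euclidean_space"
  assumes "open S" "open T"
  shows "Ck_on n T g \<Longrightarrow> Ck_on n S f \<Longrightarrow> f ` S \<subseteq> T \<Longrightarrow> Ck_on n S (\<lambda>x. g (f x))"
proof (induction n arbitrary: g)
  case 0
  then show ?case by (auto intro: continuous_on_compose2)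
next
  case (Suc n)
  note f = Ck_on_SucD[OF Suc.prems(2)] and g = Ck_on_SucD[OF Suc.prems(1)]
  have f_in: "f x \<in> T" if "x \<in> S" for x
    using that Suc.prems(3) by blast
  have D: "((\<lambda>x. g (f x)) has_derivative
      (\<lambda>v. \<Sum>b\<in>Basis. (frechet_derivative f (at x) v \<bullet> b) *\<^sub>R frechet_derivative g (at (f x)) b)) (at x)"
    if "x \<in> S" for x
    unfolding bounded_linear_eq_sum_Basis[OF has_derivative_bounded_linear[OF g(1)[OF f_in[OF that]]],
        symmetric]
    by (rule has_derivative_compose[OF f(1)[OF that] g(1)[OF f_in[OF that]]])
  have IH: "Ck_on n S (\<lambda>x. frechet_derivative g (at (f x)) b)" for b
    by (rule Suc.IH[OF g(2) Ck_on_Suc_imp[OF Suc.prems(2)] Suc.prems(3)])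
  have "Ck_on n S (\<lambda>x. \<Sum>b\<in>Basis.
      (frechet_derivative f (at x) v \<bullet> b) *\<^sub>R frechet_derivative g (at (f x)) b)" for v
    by (intro Ck_on_sum bounded_bilinear.Ck_on[OF bounded_bilinear_scaleR]
        bounded_linear.Ck_on[OF bounded_linear_inner_left] IH f(2) assms)
  with D show ?case
    by (intro Ck_on_SucI[OF assms(1)])
qed

section \<open>Closure properties of smooth functions\<close>

lemma smooth_on_subset: "smooth_on S f \<Longrightarrow> T \<subseteq> S \<Longrightarrow> smooth_on T f"
  unfolding smooth_on_def using Ck_on_subset by blast

lemma smooth_on_cong:
  "open S \<Longrightarrow> (\<And>x. x \<in> S \<Longrightarrow> f x = g x) \<Longrightarrow> smooth_on S f \<longleftrightarrow> smooth_on S g"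
  unfolding smooth_on_def using Ck_on_cong by blast

lemma smooth_on_imp_differentiable: "smooth_on S f \<Longrightarrow> x \<in> S \<Longrightarrow> f differentiable (at x)"
  unfolding smooth_on_def differentiable_def using Ck_on_SucD(1) by blast

lemma smooth_on_has_derivative:
  "smooth_on S f \<Longrightarrow> x \<in> S \<Longrightarrow> (f has_derivative frechet_derivative f (at x)) (at x)"
  by (intro has_derivative_frechet_derivative smooth_on_imp_differentiable)

lemma smooth_on_frechet_derivative_const:
  "smooth_on S f \<Longrightarrow> smooth_on S (\<lambda>x. frechet_derivative f (at x) v)"
  unfolding smooth_on_def by (intro allI Ck_on_SucD(2)) blast

lemma smooth_on_const: "open S \<Longrightarrow> smooth_on S (\<lambda>x. c)"
  unfolding smooth_on_def using Ck_on_const by blast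

lemma smooth_on_add:
  "open S \<Longrightarrow> smooth_on S f \<Longrightarrow> smooth_on S g \<Longrightarrow> smooth_on S (\<lambda>x. f x + g x)"
  unfolding smooth_on_def by (intro allI Ck_on_add) blast+

lemma smooth_on_sum:
  "open S \<Longrightarrow> (\<And>i. i \<in> I \<Longrightarrow> smooth_on S (f i)) \<Longrightarrow> smooth_on S (\<lambda>x. \<Sum>i\<in>I. f i x)"
  unfolding smooth_on_def by (intro allI Ck_on_sum) blast+

lemma (in bounded_linear) smooth_on: "open S \<Longrightarrow> smooth_on S g \<Longrightarrow> smooth_on S (\<lambda>x. f (g x))"
  unfolding smooth_on_def by (intro allI Ck_on) blast+

lemma (in bounded_bilinear) smooth_on:
  "open S \<Longrightarrow> smooth_on S f \<Longrightarrow> smooth_on S g \<Longrightarrow> smooth_on S (\<lambda>x. prod (f x) (g x))"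
  unfolding smooth_on_def by (intro allI Ck_on) blast+

lemmas smooth_on_scaleR = bounded_bilinear.smooth_on[OF bounded_bilinear_scaleR]
lemmas smooth_on_mult = bounded_bilinear.smooth_on[OF bounded_bilinear_mult]
lemmas smooth_on_inner_left = bounded_linear.smooth_on[OF bounded_linear_inner_left]
lemmas smooth_on_minus = bounded_linear.smooth_on[OF bounded_linear_minus[OF bounded_linear_ident]]

lemma smooth_on_diff:
  "open S \<Longrightarrow> smooth_on S f \<Longrightarrow> smooth_on S g \<Longrightarrow> smooth_on S (\<lambda>x. f x - g x)"
  using smooth_on_add[OF _ _ smooth_on_minus] by auto

lemma smooth_on_divide:
  fixes f g :: "'a::real_normed_vector \<Rightarrow> real"
  shows "open S \<Longrightarrow> smooth_on S f \<Longrightarrow> smooth_on S g \<Longrightarrow> (\<And>x. x \<in> S \<Longrightarrow> g x \<noteq> 0) \<Longrightarrow>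
    smooth_on S (\<lambda>x. f x / g x)"
  unfolding divide_inverse
  by (intro smooth_on_mult) (auto simp: smooth_on_def intro: Ck_on_inverse)

lemma smooth_on_compose:
  fixes f :: "'a::real_normed_vector \<Rightarrow> 'b::euclidean_space"
  assumes "open S" "open T" "smooth_on T g" "smooth_on S f" "f ` S \<subseteq> T"
  shows "smooth_on S (\<lambda>x. g (f x))"
  using assms Ck_on_compose unfolding smooth_on_def by blast

lemma smooth_on_Pair:
  fixes f :: "'a::real_normed_vector \<Rightarrow> 'b::real_normed_vector"
    and g :: "'a \<Rightarrow> 'c::real_normed_vector"
  assumes S: "open S" and f: "smooth_on S f" and g: "smooth_on S g"
  shows "smooth_on S (\<lambda>x. (f x, g x))"
proof -
  have l1: "bounded_linear (\<lambda>y. (y, 0) :: 'b \<times> 'c)" and l2: "bounded_linear (\<lambda>y. (0, y) :: 'b \<times> 'c)"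
    by (intro bounded_linear_Pair bounded_linear_ident bounded_linear_zero)+
  show ?thesis
    using smooth_on_add[OF S bounded_linear.smooth_on[OF l1 S f] bounded_linear.smooth_on[OF l2 S g]]
    by simp
qed

lemma smooth_on_dirderiv:
  fixes X :: "'m::euclidean_space \<Rightarrow> 'm"
  assumes S: "open S" and X: "smooth_on S X" and V: "smooth_on S V"
  shows "smooth_on S (dirderiv X V)"
proof -
  have eq: "dirderiv X V x = (\<Sum>b\<in>Basis. (X x \<bullet> b) *\<^sub>R frechet_derivative V (at x) b)" if "x \<in> S" for x
    unfolding dirderiv_def
    by (rule bounded_linear_eq_sum_Basis[OF has_derivative_bounded_linear])
      (rule smooth_on_has_derivative[OF V that])
  show ?thesis
    by (subst smooth_on_cong[OF S eq], assumption) (intro S smooth_on_sum smooth_on_scaleR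
        smooth_on_inner_left smooth_on_frechet_derivative_const X V)
qed

section \<open>Existence and smoothness of the Christoffel symbols\<close>

lemma bilinear_eq_sum_Basis:
  fixes B :: "'m::euclidean_space \<Rightarrow> 'n::euclidean_space \<Rightarrow> 'p::real_normed_vector"
  assumes "bilinear B"
  shows "B u v = (\<Sum>b\<in>Basis. \<Sum>c\<in>Basis. ((u \<bullet> b) * (v \<bullet> c)) *\<^sub>R B b c)"
proof -
  have "B u v = (\<Sum>b\<in>Basis. (u \<bullet> b) *\<^sub>R B b v)"
    using assms
    by (intro bounded_linear_eq_sum_Basis[of "\<lambda>u. B u v"]) (simp add: bilinear_def linear_conv_bounded_linear)
  also have "\<dots> = (\<Sum>b\<in>Basis. (u \<bullet> b) *\<^sub>R (\<Sum>c\<in>Basis. (v \<bullet> c) *\<^sub>R B b c))"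
    using assms
    by (intro sum.cong refl arg_cong[where f = "scaleR _"] bounded_linear_eq_sum_Basis)
      (simp add: bilinear_def linear_conv_bounded_linear)
  finally show ?thesis
    by (simp add: scaleR_sum_right)
qed

text \<open>Expanding both arguments in bases reduces the claim to the coefficients
  \<open>B (f x) b c\<close>. With \<open>f\<close> the identity it serves metrics and
  \<open>nabla\<close>; with \<open>f\<close> a map it serves the target symbols in
  \<open>nabla_pullback\<close>, which are evaluated at \<open>f x\<close>.\<close>

lemma smooth_on_bilinear_family:
  fixes f :: "'a::real_normed_vector \<Rightarrow> 'k::euclidean_space"
    and B :: "'k \<Rightarrow> 'm::euclidean_space \<Rightarrow> 'n::euclidean_space \<Rightarrow> 'p::real_normed_vector"
  assumes S: "open S" and T: "open T" and f: "smooth_on S f" "f ` S \<subseteq> T"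
    and B: "\<And>y. y \<in> T \<Longrightarrow> bilinear (B y)" "\<And>u v. smooth_on T (\<lambda>y. B y u v)"
    and X: "smooth_on S X" and Y: "smooth_on S Y"
  shows "smooth_on S (\<lambda>x. B (f x) (X x) (Y x))"
proof -
  have eq: "B (f x) (X x) (Y x) =
      (\<Sum>b\<in>Basis. \<Sum>c\<in>Basis. ((X x \<bullet> b) * (Y x \<bullet> c)) *\<^sub>R B (f x) b c)" if "x \<in> S" for x
    by (rule bilinear_eq_sum_Basis) (use that f(2) B(1) in blast)
  have sm: "smooth_on S (\<lambda>x. B (f x) b c)" for b c
    by (rule smooth_on_compose[OF S T B(2) f])
  show ?thesis
    by (subst smooth_on_cong[OF S eq], assumption)
      (intro sm S smooth_on_sum smooth_on_scaleR smooth_on_mult smooth_on_inner_left X Y)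
qed

section \<open>Smooth metrics and smooth Riesz representation\<close>

lemma inner_product_eqI:
  assumes "inner_product B" "\<And>w. B u w = B v w"
  shows "u = v"
proof (rule ccontr)
  assume "u \<noteq> v"
  then have "B (u - v) (u - v) > 0"
    using assms(1) by (simp add: inner_product_def)
  moreover have "B (u - v) (u - v) = 0"
    using assms(1) assms(2)[of "u - v"] bilinear_lsub[of B u v "u - v"]
    by (simp add: inner_product_def)
  ultimately show False by simp
qed

text \<open>Keeps what a Riemannian metric is within a single chart and leaves out the transition
  rule, so that the notion passes to smaller open sets and to products.\<close>

definition smooth_metric_on :: "'m::euclidean_space set \<Rightarrow> ('m \<Rightarrow> 'm \<Rightarrow> 'm \<Rightarrow> real) \<Rightarrow> bool" where
  "smooth_metric_on U g \<longleftrightarrow> open U \<and> (\<forall>x\<in>U. inner_product (g x)) \<and>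
     (\<forall>u v. smooth_on U (\<lambda>x. g x u v))"

lemma smooth_metric_on_bilinear:
  "smooth_metric_on U g \<Longrightarrow> x \<in> U \<Longrightarrow> bilinear (g x)"
  by (simp add: smooth_metric_on_def inner_product_def)

lemma smooth_metric_on_commute:
  "smooth_metric_on U g \<Longrightarrow> x \<in> U \<Longrightarrow> g x u v = g x v u"
  by (simp add: smooth_metric_on_def inner_product_def)

lemma smooth_on_ident: "open S \<Longrightarrow> smooth_on S (\<lambda>x. x)"
  unfolding smooth_on_def
proof
  show "Ck_on n S (\<lambda>x. x)" if S: "open S" for n
  proof (cases n)
    case (Suc m)
    show ?thesis
      unfolding Suc by (rule Ck_on_SucI[OF S has_derivative_ident Ck_on_const[OF S]])
  qed simp
qed

lemma smooth_on_metric: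
  assumes g: "smooth_metric_on U g" and "smooth_on U X" "smooth_on U Y"
  shows "smooth_on U (\<lambda>x. g x (X x) (Y x))"
proof -
  have U: "open U" and sm: "smooth_on U (\<lambda>x. g x u v)" for u v
    using g by (simp_all add: smooth_metric_on_def)
  show ?thesis
    by (rule smooth_on_bilinear_family[OF U U smooth_on_ident[OF U] _
        smooth_metric_on_bilinear[OF g] sm assms(2,3)]) simp
qed

text \<open>Gram-Schmidt in disguise: the residual \<open>N\<close> of \<open>b\<close> against its \<open>g\<close>-projection to
  \<open>span B\<close>, itself given by the induction hypothesis, is the new orthogonal direction.\<close>

lemma smooth_riesz_span:
  assumes g: "smooth_metric_on U g" and "finite B" "independent B"
    and "\<And>b. b \<in> B \<Longrightarrow> smooth_on U (\<lambda>x. L x b)"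
  shows "\<exists>C. smooth_on U C \<and> (\<forall>x\<in>U. C x \<in> span B \<and> (\<forall>b\<in>B. g x (C x) b = L x b))"
  using assms(2-)
proof (induction B arbitrary: L)
  case empty
  have "open U" using g by (simp add: smooth_metric_on_def)
  then show ?case
    by (intro exI[of _ "\<lambda>x. 0"]) (simp add: smooth_on_const)
next
  case (insert b B)
  have U: "open U" using g by (simp add: smooth_metric_on_def)
  have ind: "independent B" and b: "b \<notin> span B"
    using insert.prems(1) insert.hyps by (auto simp: independent_insert)
  obtain C where C: "smooth_on U C" "\<And>x. x \<in> U \<Longrightarrow> C x \<in> span B"
      "\<And>x c. x \<in> U \<Longrightarrow> c \<in> B \<Longrightarrow> g x (C x) c = L x c"
  proof -
    have "\<exists>C. smooth_on U C \<and> (\<forall>x\<in>U. C x \<in> span B \<and> (\<forall>c\<in>B. g x (C x) c = L x c))"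
      by (rule insert.IH[OF ind insert.prems(2)]) simp
    with that show ?thesis by blast
  qed
  obtain P where P: "smooth_on U P" "\<And>x. x \<in> U \<Longrightarrow> P x \<in> span B"
      "\<And>x c. x \<in> U \<Longrightarrow> c \<in> B \<Longrightarrow> g x (P x) c = g x b c"
  proof -
    have "\<exists>C. smooth_on U C \<and> (\<forall>x\<in>U. C x \<in> span B \<and> (\<forall>c\<in>B. g x (C x) c = g x b c))"
      by (rule insert.IH[OF ind]) (use g in \<open>simp add: smooth_metric_on_def\<close>)
    with that show ?thesis by blast
  qed
  define N where "N x = b - P x" for x
  have N: "smooth_on U N"
    unfolding N_def by (intro smooth_on_diff U smooth_on_const P)
  have bil: "bilinear (g x)" if "x \<in> U" for x
    using g that by (rule smooth_metric_on_bilinear)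
  have pos: "g x (N x) (N x) > 0" if "x \<in> U" for x
  proof -
    have "N x \<noteq> 0" using b P(2)[OF that] by (auto simp: N_def)
    then show ?thesis
      using g that by (simp add: smooth_metric_on_def inner_product_def)
  qed
  have orth: "g x (N x) c = 0" if "x \<in> U" "c \<in> span B" for x c
    using that(2)
  proof (induction rule: span_induct_alt)
    case base
    then show ?case using bil[OF that(1)] by (simp add: bilinear_rzero)
  next
    case (step a c d)
    then show ?case
      using bil[OF that(1)] P(3)[OF that(1) step(1)]
      by (simp add: N_def bilinear_radd bilinear_rmul bilinear_lsub)
  qed
  have Nb: "g x (N x) b = g x (N x) (N x)" if "x \<in> U" for x
  proof -
    have "g x (N x) (N x) = g x (N x) b - g x (N x) (P x)"
      by (subst (2) N_def) (simp add: bilinear_rsub[OF bil[OF that]])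
    then show ?thesis
      using orth[OF that P(2)[OF that]] by simp
  qed
  \<comment> \<open>\<open>N\<close> is orthogonal to \<open>span B\<close>, so adding a multiple of
    \<open>N\<close> to \<open>C\<close> keeps the equations for \<open>B\<close>. The equation for
    \<open>b\<close> reads g(C, b) + q g(N, b) = L(b), and g(N, b) = g(N, N) > 0 determines
    q.\<close>
  define q where "q x = (L x b - g x (C x) b) / g x (N x) (N x)" for x
  have q: "smooth_on U q"
    unfolding q_def using pos
    by (intro smooth_on_divide smooth_on_diff U smooth_on_metric[OF g] C(1) N smooth_on_const
        insert.prems(2)) (auto simp: less_imp_neq[symmetric])
  show ?case
  proof (intro exI[of _ "\<lambda>x. C x + q x *\<^sub>R N x"] conjI ballI)
    show "smooth_on U (\<lambda>x. C x + q x *\<^sub>R N x)"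
      by (intro smooth_on_add smooth_on_scaleR U C(1) q N)
  next
    fix x assume x: "x \<in> U"
    have "span B \<subseteq> span (insert b B)"
      by (intro span_mono) auto
    then show "C x + q x *\<^sub>R N x \<in> span (insert b B)"
      unfolding N_def using C(2)[OF x] P(2)[OF x]
      by (intro span_add span_scale span_diff) (auto intro: span_base)
    fix c assume "c \<in> insert b B"
    then show "g x (C x + q x *\<^sub>R N x) c = L x c"
      using pos[OF x] orth[OF x, of c] C(3)[OF x, of c]
      by (auto simp: bilinear_ladd[OF bil[OF x]] bilinear_lmul[OF bil[OF x]] Nb[OF x] q_def span_base)
  qed
qed

lemma smooth_riesz:
  fixes g :: "'m::euclidean_space \<Rightarrow> 'm \<Rightarrow> 'm \<Rightarrow> real"
  assumes g: "smooth_metric_on U g" and lin: "\<And>x. x \<in> U \<Longrightarrow> linear (L x)"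
    and L: "\<And>w. smooth_on U (\<lambda>x. L x w)"
  shows "\<exists>C. smooth_on U C \<and> (\<forall>x\<in>U. \<forall>w. g x (C x) w = L x w)"
proof -
  obtain C where C: "smooth_on U C" "\<And>x b. x \<in> U \<Longrightarrow> b \<in> Basis \<Longrightarrow> g x (C x) b = L x b"
    using smooth_riesz_span[OF g finite_Basis independent_Basis, of L] L by blast
  have "g x (C x) w = L x w" if x: "x \<in> U" for x w
  proof -
    have "linear (g x (C x))"
      using smooth_metric_on_bilinear[OF g x] by (simp add: bilinear_def)
    then show ?thesis
      using linear_eq_stdbasis[OF _ lin[OF x] C(2)[OF x]] by simp
  qed
  with C(1) show ?thesis by blast
qed

section \<open>Derivatives of a metric and the Koszul formula\<close>

definition metric_deriv :: "('m::euclidean_space \<Rightarrow> 'm \<Rightarrow> 'm \<Rightarrow> real) \<Rightarrow> 'm \<Rightarrow> 'm \<Rightarrow> 'm \<Rightarrow> 'm \<Rightarrow> real" where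
  "metric_deriv g x v w u = frechet_derivative (\<lambda>y. g y v w) (at x) u"

lemma metric_has_derivative:
  assumes "smooth_metric_on U g" "x \<in> U"
  shows "((\<lambda>y. g y v w) has_derivative metric_deriv g x v w) (at x)"
  unfolding metric_deriv_def
  by (rule smooth_on_has_derivative[of U]) (use assms in \<open>auto simp: smooth_metric_on_def\<close>)

text \<open>By uniqueness of derivatives, an algebraic identity between values of \<open>g\<close>
  on \<open>U\<close> can be differentiated. Linearity in \<open>v\<close> and \<open>w\<close> and
  symmetry of \<open>metric_deriv\<close> arise in this way from the same properties of
  \<open>g\<close>.\<close>

lemma metric_derivI:
  assumes g: "smooth_metric_on U g" and x: "x \<in> U"
    and D: "(f has_derivative D) (at x)" and eq: "\<And>y. y \<in> U \<Longrightarrow> f y = g y v w"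
  shows "metric_deriv g x v w = D"
proof -
  have "open U" using g by (simp add: smooth_metric_on_def)
  then have "((\<lambda>y. g y v w) has_derivative D) (at x)"
    using has_derivative_transform_within_open[OF D _ x eq] by blast
  then show ?thesis
    using metric_has_derivative[OF g x] has_derivative_unique by blast
qed

lemma metric_deriv_linear:
  assumes g: "smooth_metric_on U g" and x: "x \<in> U"
  shows "linear (metric_deriv g x v w)"
    and "linear (\<lambda>v. metric_deriv g x v w u)"
    and "linear (\<lambda>w. metric_deriv g x v w u)"
    and "metric_deriv g x v w u = metric_deriv g x w v u"
proof -
  note D = metric_has_derivative[OF g x]
  note bil = smooth_metric_on_bilinear[OF g]
  show "linear (metric_deriv g x v w)"
    using D by (rule has_derivative_linear)
  have add: "metric_deriv g x (v + v') w = (\<lambda>u. metric_deriv g x v w u + metric_deriv g x v' w u)" for v v' w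
    by (rule metric_derivI[OF g x has_derivative_add[OF D D]]) (simp add: bil bilinear_ladd)
  have scale: "metric_deriv g x (c *\<^sub>R v) w = (\<lambda>u. c *\<^sub>R metric_deriv g x v w u)" for c v w
    by (rule metric_derivI[OF g x has_derivative_scaleR_right[OF D]]) (simp add: bil bilinear_lmul)
  show lin: "linear (\<lambda>v. metric_deriv g x v w u)" for w
    by (rule linearI) (simp_all add: add scale)
  have sym: "metric_deriv g x v w = metric_deriv g x w v" for v w
    by (rule metric_derivI[OF g x D]) (simp add: smooth_metric_on_commute[OF g])
  then show "metric_deriv g x v w u = metric_deriv g x w v u" by simp
  show "linear (\<lambda>w. metric_deriv g x v w u)"
    using lin[of v] sym[of _ v] by simp
qed

text \<open>The Koszul formula for constant coordinate fields, whose brackets vanish, leaving three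
  derivative terms. The value is that of g(\<Gamma>(u, v), w), the Christoffel symbol of the first
  kind.\<close>

definition koszul :: "('m::euclidean_space \<Rightarrow> 'm \<Rightarrow> 'm \<Rightarrow> real) \<Rightarrow> 'm \<Rightarrow> 'm \<Rightarrow> 'm \<Rightarrow> 'm \<Rightarrow> real" where
  "koszul g x u v w = (metric_deriv g x v w u + metric_deriv g x u w v - metric_deriv g x u v w) / 2"

text \<open>Inserting metric compatibility into the three terms gives six products; by symmetry of
  \<Gamma> four cancel in pairs and two equal g(\<Gamma>(u, v), w). Conversely, nondegeneracy of g
  transfers symmetry and linearity from \<open>koszul\<close> to \<Gamma>.\<close>

lemma is_levi_civita_at_iff_koszul:
  assumes g: "smooth_metric_on U g" and x: "x \<in> U"
  shows "is_levi_civita_at g x \<Gamma> \<longleftrightarrow> (\<forall>u v w. g x (\<Gamma> u v) w = koszul g x u v w)"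
proof
  note com = smooth_metric_on_commute[OF g x]
  assume lc: "is_levi_civita_at g x \<Gamma>"
  then have D: "metric_deriv g x v w u = g x (\<Gamma> u v) w + g x v (\<Gamma> u w)" for u v w
    unfolding is_levi_civita_at_def metric_deriv_def by blast
  have s: "\<Gamma> u v = \<Gamma> v u" for u v
    using lc unfolding is_levi_civita_at_def by blast
  show "\<forall>u v w. g x (\<Gamma> u v) w = koszul g x u v w"
    unfolding koszul_def D
  proof (intro allI)
    fix u v w
    show "g x (\<Gamma> u v) w = (g x (\<Gamma> u v) w + g x v (\<Gamma> u w) + (g x (\<Gamma> v u) w + g x u (\<Gamma> v w)) -
        (g x (\<Gamma> w u) v + g x u (\<Gamma> w v))) / 2"
      using s[of v u] s[of w u] s[of w v] com[of v "\<Gamma> u w"] by simp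
  qed
next
  note com = smooth_metric_on_commute[OF g x]
  note bil = smooth_metric_on_bilinear[OF g x]
  note lin = metric_deriv_linear[OF g x]
  assume K: "\<forall>u v w. g x (\<Gamma> u v) w = koszul g x u v w"
  have inner: "inner_product (g x)"
    using g x by (simp add: smooth_metric_on_def)
  have sym: "\<Gamma> u v = \<Gamma> v u" for u v
    by (rule inner_product_eqI[OF inner]) (simp add: K koszul_def lin(4)[of u v])
  have "\<Gamma> (u + u') v = \<Gamma> u v + \<Gamma> u' v" for u u' v
    by (rule inner_product_eqI[OF inner])
      (simp add: K koszul_def bilinear_ladd[OF bil] linear_add[OF lin(1)] linear_add[OF lin(2)]
        field_simps)
  moreover have "\<Gamma> (c *\<^sub>R u) v = c *\<^sub>R \<Gamma> u v" for c u v
    by (rule inner_product_eqI[OF inner])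
      (simp add: K koszul_def bilinear_lmul[OF bil] linear_cmul[OF lin(1)] linear_cmul[OF lin(2)]
        field_simps)
  ultimately have "linear (\<lambda>u. \<Gamma> u v)" for v
    by (intro linearI)
  moreover from this have "linear (\<Gamma> u)" for u
    by (metis (no_types, lifting) ext sym)
  ultimately have "bilinear \<Gamma>"
    by (simp add: bilinear_def)
  \<comment> \<open>Compatibility is the sum of the Koszul expressions for (u, v, w) and (u, w, v):
    the derivatives along \<open>v\<close> and \<open>w\<close> cancel, and the one along
    \<open>u\<close> appears twice, halved.\<close>
  moreover have "metric_deriv g x v w u = g x (\<Gamma> u v) w + g x v (\<Gamma> u w)" for u v w
    using lin(4)[of v w u] lin(4)[of u w v] lin(4)[of u v w]
    by (simp add: K com[of v "\<Gamma> u w"] koszul_def field_simps)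
  ultimately show "is_levi_civita_at g x \<Gamma>"
    using sym unfolding is_levi_civita_at_def metric_deriv_def by blast
qed

lemma is_levi_civita_at_unique:
  assumes g: "smooth_metric_on U g" and x: "x \<in> U"
    and "is_levi_civita_at g x \<Gamma>" "is_levi_civita_at g x \<Gamma>'"
  shows "\<Gamma> = \<Gamma>'"
proof (intro ext)
  fix u v
  have "inner_product (g x)"
    using g x by (simp add: smooth_metric_on_def)
  then show "\<Gamma> u v = \<Gamma>' u v"
    using assms by (auto intro: inner_product_eqI simp: is_levi_civita_at_iff_koszul[OF g x])
qed

lemma christoffel_eqI:
  assumes "smooth_metric_on U g" "x \<in> U" "is_levi_civita_at g x \<Gamma>"
  shows "christoffel g x = \<Gamma>"
  unfolding christoffel_def using assms is_levi_civita_at_unique by (metis the_equality)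

text \<open>For fixed \<open>u\<close> and \<open>v\<close> the Koszul expression is a linear
  functional of \<open>w\<close> with smooth coefficients, so \<open>smooth_riesz\<close> yields
  existence and smoothness together.\<close>

lemma smooth_levi_civita_exists:
  assumes g: "smooth_metric_on U g"
  obtains \<Gamma> where "\<And>u v. smooth_on U (\<lambda>x. \<Gamma> x u v)" "\<And>x. x \<in> U \<Longrightarrow> is_levi_civita_at g x (\<Gamma> x)"
proof -
  have U: "open U" and sm: "\<And>u v. smooth_on U (\<lambda>x. g x u v)"
    using g by (auto simp: smooth_metric_on_def)
  have smD: "smooth_on U (\<lambda>x. metric_deriv g x v w u)" for u v w
    unfolding metric_deriv_def by (intro smooth_on_frechet_derivative_const sm)
  have "\<exists>C. smooth_on U C \<and> (\<forall>x\<in>U. \<forall>w. g x (C x) w = koszul g x u v w)" for u v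
  proof (rule smooth_riesz[OF g])
    show "linear (koszul g x u v)" if "x \<in> U" for x
      by (intro linearI) (simp_all add: koszul_def field_simps
          linear_add[OF metric_deriv_linear(1)[OF g that]]
          linear_cmul[OF metric_deriv_linear(1)[OF g that]]
          linear_add[OF metric_deriv_linear(3)[OF g that]]
          linear_cmul[OF metric_deriv_linear(3)[OF g that]])
    show "smooth_on U (\<lambda>x. koszul g x u v w)" for w
      unfolding koszul_def
      by (intro smooth_on_divide smooth_on_add smooth_on_diff smD smooth_on_const U) simp
  qed
  then obtain C where "\<And>u v. smooth_on U (C u v)"
      "\<And>u v x w. x \<in> U \<Longrightarrow> g x (C u v x) w = koszul g x u v w"
    by metis
  then show thesis
    by (intro that[of "\<lambda>x u v. C u v x"]) (simp_all add: is_levi_civita_at_iff_koszul[OF g])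
qed

lemma is_levi_civita_at_christoffel:
  assumes g: "smooth_metric_on U g" and x: "x \<in> U"
  shows "is_levi_civita_at g x (christoffel g x)"
  using smooth_levi_civita_exists[OF g] christoffel_eqI[OF g x] x by metis

lemma bilinear_christoffel:
  "smooth_metric_on U g \<Longrightarrow> x \<in> U \<Longrightarrow> bilinear (christoffel g x)"
  using is_levi_civita_at_christoffel unfolding is_levi_civita_at_def by blast

text \<open>On \<open>U\<close>, \<open>christoffel\<close> coincides by uniqueness with the smooth
  family just constructed.\<close>

lemma smooth_on_christoffel:
  assumes g: "smooth_metric_on U g"
  shows "smooth_on U (\<lambda>x. christoffel g x u v)"
proof -
  obtain \<Gamma> where \<Gamma>: "\<And>u v. smooth_on U (\<lambda>x. \<Gamma> x u v)" "\<And>x. x \<in> U \<Longrightarrow> is_levi_civita_at g x (\<Gamma> x)"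
    using smooth_levi_civita_exists[OF g] by blast
  have "open U" using g by (simp add: smooth_metric_on_def)
  then show ?thesis
    using \<Gamma>(1) smooth_on_cong[of U "\<lambda>x. christoffel g x u v" "\<lambda>x. \<Gamma> x u v"]
      christoffel_eqI[OF g _ \<Gamma>(2)] by simp
qed

section \<open>Product metrics\<close>

text \<open>Free of charts, so that the calculus on open subsets of the product space does not
  mention manifolds; \<open>product_manifold_simps\<close> identifies it with the metric of
  \<open>product_manifold\<close> in a product chart.\<close>

definition product_metric :: "('m::euclidean_space \<Rightarrow> 'm \<Rightarrow> 'm \<Rightarrow> real) \<Rightarrow>
    ('n::euclidean_space \<Rightarrow> 'n \<Rightarrow> 'n \<Rightarrow> real) \<Rightarrow> 'm \<times> 'n \<Rightarrow> 'm \<times> 'n \<Rightarrow> 'm \<times> 'n \<Rightarrow> real" where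
  "product_metric g h = (\<lambda>(x, y) (u, u') (v, v'). g x u v + h y u' v')"

lemma product_metric_simp [simp]:
  "product_metric g h (x, y) (u, u') (v, v') = g x u v + h y u' v'"
  by (simp add: product_metric_def)

lemma inner_product_product_metric:
  assumes "inner_product (g x)" "inner_product (h y)"
  shows "inner_product (product_metric g h (x, y))"
proof -
  note bil = assms[unfolded inner_product_def, THEN conjunct1]
  have nonneg: "B u u \<ge> 0" if "inner_product B" for B :: "'z::real_vector \<Rightarrow> 'z \<Rightarrow> real" and u
    using that by (cases "u = 0") (auto simp: inner_product_def bilinear_lzero less_imp_le)
  have "bilinear (product_metric g h (x, y))"
    unfolding bilinear_def
    by (intro allI conjI linearI)
      (auto simp: split_paired_all bilinear_ladd[OF bil(1)] bilinear_ladd[OF bil(2)]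
        bilinear_radd[OF bil(1)] bilinear_radd[OF bil(2)] bilinear_lmul[OF bil(1)]
        bilinear_lmul[OF bil(2)] bilinear_rmul[OF bil(1)] bilinear_rmul[OF bil(2)] algebra_simps)
  moreover have "product_metric g h (x, y) u v = product_metric g h (x, y) v u" for u v
    using assms by (cases u; cases v) (simp add: inner_product_def)
  moreover have "product_metric g h (x, y) u u > 0" if "u \<noteq> 0" for u
  proof (cases u)
    case (Pair u1 u2)
    then have "u1 \<noteq> 0 \<or> u2 \<noteq> 0"
      using that by (auto simp: zero_prod_def)
    then show ?thesis
      using assms nonneg[OF assms(1), of u1] nonneg[OF assms(2), of u2] Pair
      by (auto simp: inner_product_def add_pos_nonneg add_nonneg_pos)
  qed
  ultimately show ?thesis
    by (simp add: inner_product_def)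
qed

lemma smooth_metric_on_product_metric:
  assumes g: "smooth_metric_on U g" and h: "smooth_metric_on U' h"
  shows "smooth_metric_on (U \<times> U') (product_metric g h)"
proof -
  have op: "open U" "open U'"
    using g h by (auto simp: smooth_metric_on_def)
  then have W: "open (U \<times> U')" by (rule open_Times)
  have "smooth_on (U \<times> U') (\<lambda>z. g (fst z) u v + h (snd z) u' v')" for u u' v v'
  proof (rule smooth_on_add[OF W])
    show "smooth_on (U \<times> U') (\<lambda>z. g (fst z) u v)"
      by (rule smooth_on_compose[OF W op(1), of "\<lambda>x. g x u v"])
        (use g in \<open>auto simp: smooth_metric_on_def
          intro: bounded_linear.smooth_on[OF bounded_linear_fst W smooth_on_ident[OF W]]\<close>)
    show "smooth_on (U \<times> U') (\<lambda>z. h (snd z) u' v')"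
      by (rule smooth_on_compose[OF W op(2), of "\<lambda>x. h x u' v'"])
        (use h in \<open>auto simp: smooth_metric_on_def
          intro: bounded_linear.smooth_on[OF bounded_linear_snd W smooth_on_ident[OF W]]\<close>)
  qed
  then have "smooth_on (U \<times> U') (\<lambda>z. product_metric g h z u v)" for u v
    by (cases u; cases v) (simp add: product_metric_def split_def)
  then show ?thesis
    using W g h by (auto simp: smooth_metric_on_def intro: inner_product_product_metric)
qed

text \<open>Each summand of the metric depends on one coordinate of the base point only, so no mixed
  derivatives occur.\<close>

lemma metric_deriv_product_metric:
  assumes g: "smooth_metric_on U g" and h: "smooth_metric_on U' h" and x: "x \<in> U" and y: "y \<in> U'"
  shows "metric_deriv (product_metric g h) (x, y) (v, v') (w, w') =
    (\<lambda>(u, u'). metric_deriv g x v w u + metric_deriv h y v' w' u')"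
proof -
  have D1: "((\<lambda>z. g (fst z) v w) has_derivative (\<lambda>u. metric_deriv g x v w (fst u))) (at (x, y))"
    by (rule has_derivative_compose[OF has_derivative_fst[OF has_derivative_ident]])
      (simp add: metric_has_derivative[OF g x])
  have D2: "((\<lambda>z. h (snd z) v' w') has_derivative (\<lambda>u. metric_deriv h y v' w' (snd u))) (at (x, y))"
    by (rule has_derivative_compose[OF has_derivative_snd[OF has_derivative_ident]])
      (simp add: metric_has_derivative[OF h y])
  have "(x, y) \<in> U \<times> U'" using x y by simp
  from metric_derivI[OF smooth_metric_on_product_metric[OF g h] this has_derivative_add[OF D1 D2]]
  show ?thesis by (auto simp: split_def)
qed

text \<open>Since \<open>metric_deriv\<close> splits, the Koszul expression of the product is the
  sum of those of the factors. The pair of symbols therefore satisfies the formula that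
  characterizes the connection.\<close>

lemma christoffel_product_metric:
  assumes g: "smooth_metric_on U g" and h: "smooth_metric_on U' h" and x: "x \<in> U" and y: "y \<in> U'"
  shows "christoffel (product_metric g h) (x, y) (u, u') (v, v') =
    (christoffel g x u v, christoffel h y u' v')"
proof -
  note P = smooth_metric_on_product_metric[OF g h]
  have xy: "(x, y) \<in> U \<times> U'" using x y by simp
  have K: "g x (christoffel g x u v) w = koszul g x u v w"
      "h y (christoffel h y u' v') w' = koszul h y u' v' w'" for u v w u' v' w'
    using is_levi_civita_at_christoffel[OF g x] is_levi_civita_at_christoffel[OF h y]
    by (simp_all add: is_levi_civita_at_iff_koszul[OF g x] is_levi_civita_at_iff_koszul[OF h y])
  have "is_levi_civita_at (product_metric g h) (x, y)
      (\<lambda>(u, u') (v, v'). (christoffel g x u v, christoffel h y u' v'))"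
    by (auto simp: is_levi_civita_at_iff_koszul[OF P xy] K koszul_def
        metric_deriv_product_metric[OF g h x y] field_simps)
  from christoffel_eqI[OF P xy this] show ?thesis
    by simp
qed

text \<open>Agreement on \<open>W\<close> is asked of \<open>Z\<close>, rather than equality of
  functions, because iterated fields are known to be pairs only on \<open>W\<close>.\<close>

lemma dirderiv_Pair:
  assumes W: "open W" "x \<in> W" and V: "smooth_on W V" "smooth_on W V'"
    and eq: "\<And>y. y \<in> W \<Longrightarrow> Z y = (V y, V' y)"
  shows "dirderiv X Z x = (dirderiv X V x, dirderiv X V' x)"
proof -
  have "frechet_derivative Z (at x) = frechet_derivative (\<lambda>y. (V y, V' y)) (at x)"
    by (rule frechet_derivative_cong_open[OF W eq])
  also have "\<dots> = (\<lambda>v. (frechet_derivative V (at x) v, frechet_derivative V' (at x) v))"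
    by (rule frechet_derivative_at[symmetric])
      (intro has_derivative_Pair smooth_on_has_derivative[OF _ W(2)] V)
  finally show ?thesis by (simp add: dirderiv_def)
qed

lemma dirderiv_cong_zero:
  assumes "open W" "x \<in> W" "\<And>y. y \<in> W \<Longrightarrow> V y = 0"
  shows "dirderiv X V x = 0"
  unfolding dirderiv_def using frechet_derivative_cong_open[OF assms] by simp

text \<open>For constant fields the bracket and the inner derivatives vanish, and what remains is
  the coordinate formula D\<Gamma> + \<Gamma>\<Gamma>, antisymmetrized in \<open>u\<close> and
  \<open>v\<close>. The bracket term becomes \<open>christoffel h y 0 w\<close>, which is zero by
  bilinearity.\<close>

lemma curvature_eq:
  assumes h: "smooth_metric_on U h" and y: "y \<in> U"
  shows "curvature h y u v w =
    dirderiv (\<lambda>_. u) (\<lambda>z. christoffel h z v w) y + christoffel h y u (christoffel h y v w) -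
    (dirderiv (\<lambda>_. v) (\<lambda>z. christoffel h z u w) y + christoffel h y v (christoffel h y u w))"
proof -
  have const: "dirderiv X (\<lambda>_. c) = (\<lambda>_. 0)" for X :: "'a \<Rightarrow> 'a" and c :: 'a
    by (simp add: dirderiv_def)
  have nab: "nabla h (\<lambda>_. v) (\<lambda>_. w) = (\<lambda>z. christoffel h z v w)" for v w
    by (simp add: nabla_def const)
  show ?thesis
    unfolding curvature_def curvature_field_def lie_bracket_def const nab
    by (simp add: nab) (simp add: nabla_def bilinear_lzero[OF bilinear_christoffel[OF h y]])
qed

text \<open>The zero sits in the slot that receives the iterated Laplacian in
  \<open>curvature_trace\<close>. The derivative of \<open>christoffel h z 0 w\<close> vanishes
  because this function is zero on all of \<open>U\<close>, not merely at \<open>y\<close>.\<close>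

lemma curvature_zero:
  assumes h: "smooth_metric_on U h" and y: "y \<in> U"
  shows "curvature h y 0 v w = 0"
proof -
  have U: "open U" using h by (simp add: smooth_metric_on_def)
  note bil = bilinear_christoffel[OF h]
  have "linear (frechet_derivative (\<lambda>z. christoffel h z v w) (at y))"
    by (rule has_derivative_linear[OF smooth_on_has_derivative[OF smooth_on_christoffel[OF h] y]])
  then have "dirderiv (\<lambda>_. 0) (\<lambda>z. christoffel h z v w) y = 0"
    by (simp add: dirderiv_def linear_0)
  moreover have "dirderiv (\<lambda>_. v) (\<lambda>z. christoffel h z 0 w) y = 0"
    by (rule dirderiv_cong_zero[OF U y]) (simp add: bilinear_lzero[OF bil])
  ultimately show ?thesis
    by (simp add: curvature_eq[OF h y] bilinear_lzero[OF bil[OF y]] bilinear_rzero[OF bil[OF y]])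
qed

text \<open>In the coordinate formula the quadratic terms split with the symbols. The derivative
  terms split because each component of the product symbols is a smooth function of one
  coordinate.\<close>

lemma curvature_product_metric:
  assumes g: "smooth_metric_on U g" and h: "smooth_metric_on U' h" and x: "x \<in> U" and y: "y \<in> U'"
  shows "curvature (product_metric g h) (x, y) (u, u') (v, v') (w, w') =
    (curvature g x u v w, curvature h y u' v' w')"
proof -
  note P = smooth_metric_on_product_metric[OF g h]
  have xy: "(x, y) \<in> U \<times> U'" using x y by simp
  have D: "dirderiv (\<lambda>_. (u, u')) (\<lambda>z. christoffel (product_metric g h) z (v, v') (w, w')) (x, y) =
      (dirderiv (\<lambda>_. u) (\<lambda>z. christoffel g z v w) x, dirderiv (\<lambda>_. u') (\<lambda>z. christoffel h z v' w') y)"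
    for u u' v v' w w'
  proof -
    have D1: "((\<lambda>z. christoffel g (fst z) v w) has_derivative
        (\<lambda>u. frechet_derivative (\<lambda>z. christoffel g z v w) (at x) (fst u))) (at (x, y))"
      by (rule has_derivative_compose[OF has_derivative_fst[OF has_derivative_ident]])
        (simp add: smooth_on_has_derivative[OF smooth_on_christoffel[OF g] x])
    have D2: "((\<lambda>z. christoffel h (snd z) v' w') has_derivative
        (\<lambda>u. frechet_derivative (\<lambda>z. christoffel h z v' w') (at y) (snd u))) (at (x, y))"
      by (rule has_derivative_compose[OF has_derivative_snd[OF has_derivative_ident]])
        (simp add: smooth_on_has_derivative[OF smooth_on_christoffel[OF h] y])
    have "frechet_derivative (\<lambda>z. christoffel (product_metric g h) z (v, v') (w, w')) (at (x, y)) =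
        frechet_derivative (\<lambda>z. (christoffel g (fst z) v w, christoffel h (snd z) v' w')) (at (x, y))"
      by (rule frechet_derivative_cong_open[OF _ xy])
        (use P in \<open>auto simp: smooth_metric_on_def christoffel_product_metric[OF g h]\<close>)
    then show ?thesis
      using frechet_derivative_at[OF has_derivative_Pair[OF D1 D2], symmetric]
      by (simp add: dirderiv_def)
  qed
  show ?thesis
    by (simp add: curvature_eq[OF P xy] curvature_eq[OF g x] curvature_eq[OF h y] D
        christoffel_product_metric[OF g h x y])
qed

section \<open>Tension fields in charts\<close>

lemma sum_Pair: "(\<Sum>a\<in>A. (p a, q a)) = (sum p A, sum q A)"
  by (simp add: prod_eq_iff fst_sum snd_sum)

text \<open>A map in coordinates: \<open>W\<close> carries the fields of the domain, and
  \<open>f\<close> sends it into the single chart image \<open>U\<close>. Under these conditions all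
  operators preserve smoothness on \<open>W\<close>, so they can be iterated.\<close>

locale chart_map =
  fixes W :: "'m::euclidean_space set" and g and e :: "nat \<Rightarrow> 'm \<Rightarrow> 'm"
    and U :: "'n::euclidean_space set" and h f
  assumes g: "smooth_metric_on W g"
    and e: "\<And>a. a < DIM('m) \<Longrightarrow> smooth_on W (e a)"
    and h: "smooth_metric_on U h"
    and f: "smooth_on W f" "f ` W \<subseteq> U"
begin

lemma open_W: "open W"
  using g by (simp add: smooth_metric_on_def)

lemma open_U: "open U"
  using h by (simp add: smooth_metric_on_def)

lemma f_in: "x \<in> W \<Longrightarrow> f x \<in> U"
  using f(2) by blast

lemma smooth_on_nabla: "smooth_on W X \<Longrightarrow> smooth_on W Y \<Longrightarrow> smooth_on W (nabla g X Y)"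
  unfolding nabla_def
  by (intro smooth_on_add[OF open_W] smooth_on_dirderiv[OF open_W]
      smooth_on_bilinear_family[OF open_W open_W smooth_on_ident[OF open_W] _
        bilinear_christoffel[OF g] smooth_on_christoffel[OF g]]) simp_all

lemma smooth_on_nabla_pullback:
  "smooth_on W X \<Longrightarrow> smooth_on W V \<Longrightarrow> smooth_on W (nabla_pullback h f X V)"
  unfolding nabla_pullback_def
  by (intro smooth_on_add[OF open_W] smooth_on_dirderiv[OF open_W] f
      smooth_on_bilinear_family[OF open_W open_U f bilinear_christoffel[OF h] smooth_on_christoffel[OF h]])

lemma smooth_on_tension: "smooth_on W (tension g h e f)"
  unfolding tension_def
  by (intro smooth_on_sum[OF open_W] smooth_on_diff[OF open_W] smooth_on_nabla_pullback
      smooth_on_dirderiv[OF open_W] smooth_on_nabla f) (simp_all add: e)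

lemma smooth_on_rough_laplacian:
  "smooth_on W V \<Longrightarrow> smooth_on W (rough_laplacian g h e f V)"
  unfolding rough_laplacian_def
  by (intro smooth_on_minus[OF open_W] smooth_on_sum[OF open_W] smooth_on_diff[OF open_W]
      smooth_on_nabla_pullback smooth_on_nabla) (simp_all add: e)

lemma smooth_on_rough_laplacian_iter:
  "smooth_on W V \<Longrightarrow> smooth_on W ((rough_laplacian g h e f ^^ n) V)"
  by (induction n) (simp_all add: smooth_on_rough_laplacian)

lemma nabla_pullback_zero:
  assumes "\<And>y. y \<in> W \<Longrightarrow> V y = 0" "x \<in> W"
  shows "nabla_pullback h f X V x = 0"
  using dirderiv_cong_zero[OF open_W assms(2,1)] assms
  by (simp add: nabla_pullback_def bilinear_rzero[OF bilinear_christoffel[OF h f_in]])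

lemma rough_laplacian_iter_zero:
  assumes "\<And>y. y \<in> W \<Longrightarrow> V y = 0"
  shows "x \<in> W \<Longrightarrow> (rough_laplacian g h e f ^^ n) V x = 0"
proof (induction n arbitrary: x)
  case (Suc n)
  then show ?case
    by (simp add: rough_laplacian_def nabla_pullback_zero)
qed (simp add: assms)

lemma k_tension_zero:
  assumes "\<And>y. y \<in> W \<Longrightarrow> tension g h e f y = 0" "x \<in> W"
  shows "k_tension k g h e f x = 0"
  using assms
  by (simp add: k_tension_def curvature_trace_def rough_laplacian_iter_zero
      curvature_zero[OF h f_in])

end

text \<open>Both maps share \<open>W\<close>, \<open>g\<close> and the frame, since these belong to
  the common domain.\<close>

locale product_chart_map =
  M1: chart_map W g e U1 h1 f1 + M2: chart_map W g e U2 h2 f2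
  for W :: "'m::euclidean_space set" and g e
    and U1 :: "'n1::euclidean_space set" and h1 f1
    and U2 :: "'n2::euclidean_space set" and h2 f2
begin

abbreviation "h12 \<equiv> product_metric h1 h2"
abbreviation "f12 \<equiv> \<lambda>x. (f1 x, f2 x)"

lemma nabla_pullback_Pair:
  assumes "\<And>y. y \<in> W \<Longrightarrow> V y = (V1 y, V2 y)" "smooth_on W V1" "smooth_on W V2" "x \<in> W"
  shows "nabla_pullback h12 f12 X V x = (nabla_pullback h1 f1 X V1 x, nabla_pullback h2 f2 X V2 x)"
  using assms M1.f_in M2.f_in
  by (simp add: nabla_pullback_def dirderiv_Pair[OF M1.open_W assms(4,2,3,1)]
      dirderiv_Pair[OF M1.open_W assms(4) M1.f(1) M2.f(1)]
      christoffel_product_metric[OF M1.h M2.h])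

lemma tension_Pair:
  assumes x: "x \<in> W"
  shows "tension g h12 e f12 x = (tension g h1 e f1 x, tension g h2 e f2 x)"
proof -
  note D = dirderiv_Pair[OF M1.open_W _ M1.f(1) M2.f(1) refl]
  have "nabla_pullback h12 f12 (e a) (dirderiv (e a) f12) x =
      (nabla_pullback h1 f1 (e a) (dirderiv (e a) f1) x, nabla_pullback h2 f2 (e a) (dirderiv (e a) f2) x)"
    if "a < DIM('m)" for a
    by (rule nabla_pullback_Pair[OF D _ _ x])
      (auto intro: smooth_on_dirderiv[OF M1.open_W] M1.e M1.f M2.f that)
  then show ?thesis
    unfolding tension_def by (simp add: D[OF x] sum_Pair)
qed

lemma rough_laplacian_Pair:
  assumes V: "\<And>y. y \<in> W \<Longrightarrow> V y = (V1 y, V2 y)" "smooth_on W V1" "smooth_on W V2"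
    and x: "x \<in> W"
  shows "rough_laplacian g h12 e f12 V x = (rough_laplacian g h1 e f1 V1 x, rough_laplacian g h2 e f2 V2 x)"
proof -
  have "nabla_pullback h12 f12 (e a) (nabla_pullback h12 f12 (e a) V) x =
      (nabla_pullback h1 f1 (e a) (nabla_pullback h1 f1 (e a) V1) x,
       nabla_pullback h2 f2 (e a) (nabla_pullback h2 f2 (e a) V2) x)"
    if "a < DIM('m)" for a
    \<comment> \<open>The inner instance shows on all of \<open>W\<close> that the first derivative
      is a pair; this is the hypothesis under which the outer one differentiates it again.\<close>
    by (rule nabla_pullback_Pair[OF nabla_pullback_Pair[OF V] _ _ x])
      (auto intro: M1.smooth_on_nabla_pullback M2.smooth_on_nabla_pullback M1.e V that)
  then show ?thesis
    unfolding rough_laplacian_def by (simp add: nabla_pullback_Pair[OF V x] sum_Pair)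
qed

text \<open>One more Laplacian needs the splitting of the previous iterate throughout
  \<open>W\<close>, hence an induction with the point kept arbitrary.\<close>

lemma rough_laplacian_iter_tension_Pair:
  "x \<in> W \<Longrightarrow> (rough_laplacian g h12 e f12 ^^ n) (tension g h12 e f12) x =
    ((rough_laplacian g h1 e f1 ^^ n) (tension g h1 e f1) x,
     (rough_laplacian g h2 e f2 ^^ n) (tension g h2 e f2) x)"
proof (induction n arbitrary: x)
  case 0
  then show ?case by (simp add: tension_Pair)
next
  case (Suc n)
  show ?case
    unfolding funpow.simps comp_apply
    by (rule rough_laplacian_Pair[OF Suc.IH _ _ Suc.prems])
      (auto intro: M1.smooth_on_rough_laplacian_iter M1.smooth_on_tension
        M2.smooth_on_rough_laplacian_iter M2.smooth_on_tension)
qed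

lemma k_tension_Pair:
  assumes x: "x \<in> W"
  shows "k_tension k g h12 e f12 x = (k_tension k g h1 e f1 x, k_tension k g h2 e f2 x)"
  by (simp add: k_tension_def tension_Pair[OF x] rough_laplacian_iter_tension_Pair[OF x]
      curvature_trace_def dirderiv_Pair[OF M1.open_W x M1.f(1) M2.f(1) refl]
      curvature_product_metric[OF M1.h M2.h M1.f_in[OF x] M2.f_in[OF x]] sum_Pair)

end

section \<open>Passage to manifolds\<close>

lemma smooth_manifold_chartD:
  assumes "smooth_manifold M" "i \<in> idx M"
  shows "openin (mtop M) (dom M i)" "open (chart M i ` dom M i)"
    "homeomorphic_map (subtopology (mtop M) (dom M i)) (top_of_set (chart M i ` dom M i)) (chart M i)"
  using assms unfolding smooth_manifold_def by blast+

text \<open>A homeomorphism gives openness relative to the chart image, which is itself open in the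
  Euclidean space.\<close>

lemma open_chart_image:
  assumes M: "smooth_manifold M" "i \<in> idx M" and A: "openin (mtop M) A" "A \<subseteq> dom M i"
  shows "open (chart M i ` A)"
proof -
  note chart = smooth_manifold_chartD[OF M]
  have "openin (subtopology (mtop M) (dom M i)) A"
    using A by (meson openin_subset_topspace_eq openin_subtopology_Int2 openin_open_subtopology chart(1))
  then have "openin (top_of_set (chart M i ` dom M i)) (chart M i ` A)"
    using homeomorphic_imp_open_map[OF chart(3)] by (simp add: open_map_def)
  then show ?thesis
    using chart(2) openin_open_eq by blast
qed

lemma chart_inv_chart:
  assumes M: "smooth_manifold M" "i \<in> idx M" and p: "p \<in> dom M i"
  shows "chart_inv M i (chart M i p) = p"
proof -
  note chart = smooth_manifold_chartD[OF M]
  have "inj_on (chart M i) (dom M i)"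
    using homeomorphic_imp_injective_map[OF chart(3)] openin_subset[OF chart(1)]
    by (simp add: Int_absorb1)
  then show ?thesis
    using p by (simp add: chart_inv_def)
qed

lemma openin_chart_preimage:
  assumes M: "smooth_manifold M" "i \<in> idx M" and N: "smooth_manifold N" "j \<in> idx N"
    and \<phi>: "smooth_map M N \<phi>"
  shows "openin (mtop M) {p \<in> dom M i. \<phi> p \<in> dom N j}"
proof -
  note dM = smooth_manifold_chartD(1)[OF M] and dN = smooth_manifold_chartD(1)[OF N]
  have "openin (mtop M) (dom M i \<inter> {p \<in> topspace (mtop M). \<phi> p \<in> dom N j})"
    using \<phi> dM dN by (intro openin_Int openin_continuous_map_preimage) (auto simp: smooth_map_def)
  moreover have "dom M i \<inter> {p \<in> topspace (mtop M). \<phi> p \<in> dom N j} = {p \<in> dom M i. \<phi> p \<in> dom N j}"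
    using openin_subset[OF dM] by blast
  ultimately show ?thesis by simp
qed

lemma riemannian_smooth_metric_on:
  assumes "riemannian_manifold M" "i \<in> idx M"
  shows "smooth_metric_on (chart M i ` dom M i) (metric M i)"
  using assms smooth_manifold_chartD(2)[of M i]
  by (simp add: riemannian_manifold_def smooth_metric_on_def)

lemma smooth_metric_on_subset:
  "smooth_metric_on U g \<Longrightarrow> open W \<Longrightarrow> W \<subseteq> U \<Longrightarrow> smooth_metric_on W g"
  unfolding smooth_metric_on_def using smooth_on_subset by blast

text \<open>\<open>V\<close> may contain coordinates of points that \<phi> sends outside
  \<open>dom N j\<close>, where the local representative has no geometric meaning; hence the
  restriction to \<open>W\<close>.\<close>

lemma chart_map_local_rep:
  fixes M :: "('a, 'i, 'm::euclidean_space) rmanifold" and N :: "('b, 'j, 'n::euclidean_space) rmanifold"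
  assumes M: "riemannian_manifold M" "i \<in> idx M" and N: "riemannian_manifold N" "j \<in> idx N"
    and \<phi>: "smooth_map M N \<phi>" and e: "orthonormal_frame_on (metric M i) V e"
    and W: "open W" "W \<subseteq> V" "W \<subseteq> chart M i ` {p \<in> dom M i. \<phi> p \<in> dom N j}"
  shows "chart_map W (metric M i) e (chart N j ` dom N j) (metric N j) (local_rep M N \<phi> i j)"
proof
  show "smooth_metric_on W (metric M i)"
    using W by (intro smooth_metric_on_subset[OF riemannian_smooth_metric_on[OF M]]) auto
  show "smooth_on W (e a)" if "a < DIM('m)" for a
    by (rule smooth_on_subset[OF _ W(2)]) (use e that in \<open>simp add: orthonormal_frame_on_def\<close>)
  show "smooth_metric_on (chart N j ` dom N j) (metric N j)"
    by (rule riemannian_smooth_metric_on[OF N])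
  show "smooth_on W (local_rep M N \<phi> i j)"
    by (rule smooth_on_subset[OF _ W(3)]) (use \<phi> M(2) N(2) in \<open>simp add: smooth_map_def\<close>)
  have sm: "smooth_manifold M"
    using M(1) by (simp add: riemannian_manifold_def)
  show "local_rep M N \<phi> i j ` W \<subseteq> chart N j ` dom N j"
  proof
    fix y assume "y \<in> local_rep M N \<phi> i j ` W"
    then obtain p where "p \<in> dom M i" "\<phi> p \<in> dom N j" "y = local_rep M N \<phi> i j (chart M i p)"
      using W(3) by blast
    then show "y \<in> chart N j ` dom N j"
      by (simp add: local_rep_def chart_inv_chart[OF sm M(2)])
  qed
qed

lemma k_harmonicD:
  assumes "k_harmonic k M N \<phi>" "p \<in> topspace (mtop M)" "i \<in> idx M" "j \<in> idx N" "p \<in> dom M i"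
    "\<phi> p \<in> dom N j" "open V" "chart M i p \<in> V" "V \<subseteq> chart M i ` dom M i"
    "orthonormal_frame_on (metric M i) V e"
  shows "k_tension k (metric M i) (metric N j) e (local_rep M N \<phi> i j) (chart M i p) = 0"
  using assms(1)[unfolded k_harmonic_def, THEN conjunct2, rule_format, OF assms(2-4)] assms(5-)
  by simp

lemma k_harmonicI:
  assumes "smooth_map M N \<phi>"
    and "\<And>p i j V e. p \<in> topspace (mtop M) \<Longrightarrow> i \<in> idx M \<Longrightarrow> j \<in> idx N \<Longrightarrow> p \<in> dom M i \<Longrightarrow>
      \<phi> p \<in> dom N j \<Longrightarrow> open V \<Longrightarrow> chart M i p \<in> V \<Longrightarrow> V \<subseteq> chart M i ` dom M i \<Longrightarrow>
      orthonormal_frame_on (metric M i) V e \<Longrightarrow>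
      k_tension k (metric M i) (metric N j) e (local_rep M N \<phi> i j) (chart M i p) = 0"
  shows "k_harmonic k M N \<phi>"
  unfolding k_harmonic_def
  by (intro conjI assms(1) ballI allI impI, elim conjE, rule assms(2))

text \<open>Harmonicity is stated point by point. Each point with coordinates in \<open>W\<close> is
  an instance for the same \<open>V\<close> and the same frame, so the tension field vanishes on the
  open set \<open>W\<close>, as \<open>k_tension_zero\<close> demands.\<close>

lemma harmonic_imp_k_harmonic:
  assumes M: "riemannian_manifold M" and N: "riemannian_manifold N" and \<phi>: "harmonic M N \<phi>"
  shows "k_harmonic k M N \<phi>"
proof (rule k_harmonicI)
  show sm: "smooth_map M N \<phi>"
    using \<phi> by (simp add: k_harmonic_def)
  fix p i j V e
  assume p: "p \<in> topspace (mtop M)" "p \<in> dom M i" "\<phi> p \<in> dom N j" and i: "i \<in> idx M" and j: "j \<in> idx N"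
    and V: "open V" "chart M i p \<in> V" "V \<subseteq> chart M i ` dom M i"
    and e: "orthonormal_frame_on (metric M i) V e"
  have smM: "smooth_manifold M" and smN: "smooth_manifold N"
    using M N by (simp_all add: riemannian_manifold_def)
  define A where "A = {p \<in> dom M i. \<phi> p \<in> dom N j}"
  define W where "W = V \<inter> chart M i ` A"
  have "open (chart M i ` A)"
    unfolding A_def using openin_chart_preimage[OF smM i smN j sm] by (rule open_chart_image[OF smM i]) auto
  then have W: "open W"
    unfolding W_def by (rule open_Int[OF V(1)])
  interpret C: chart_map W "metric M i" e "chart N j ` dom N j" "metric N j" "local_rep M N \<phi> i j"
    by (rule chart_map_local_rep[OF M i N j sm e W]) (auto simp: W_def A_def)
  show "k_tension k (metric M i) (metric N j) e (local_rep M N \<phi> i j) (chart M i p) = 0"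
  proof (rule C.k_tension_zero)
    show "chart M i p \<in> W"
      using p V by (auto simp: W_def A_def)
    fix y assume y: "y \<in> W"
    then obtain q where q: "q \<in> dom M i" "\<phi> q \<in> dom N j" "y = chart M i q" "y \<in> V"
      by (auto simp: W_def A_def)
    have "q \<in> topspace (mtop M)"
      using q(1) smooth_manifold_chartD(1)[OF smM i] openin_subset by blast
    then have "k_tension 1 (metric M i) (metric N j) e (local_rep M N \<phi> i j) (chart M i q) = 0"
      using q by (intro k_harmonicD[OF \<phi> _ i j _ _ V(1) _ V(3) e]) simp_all
    then show "tension (metric M i) (metric N j) e (local_rep M N \<phi> i j) y = 0"
      using q(3) by (simp add: k_tension_def)
  qed
qed

section \<open>Maps into a product manifold\<close>

lemma product_manifold_simps [simp]:
  "mtop (product_manifold M N) = prod_topology (mtop M) (mtop N)"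
  "idx (product_manifold M N) = idx M \<times> idx N"
  "dom (product_manifold M N) (j, l) = dom M j \<times> dom N l"
  "metric (product_manifold M N) (j, l) = product_metric (metric M j) (metric N l)"
  by (simp_all add: product_manifold_def product_metric_def)

lemma local_rep_product_manifold:
  "local_rep M (product_manifold N1 N2) (\<lambda>x. (\<phi> x, \<psi> x)) i (j, l) =
    (\<lambda>x. (local_rep M N1 \<phi> i j x, local_rep M N2 \<psi> i l x))"
  by (simp add: local_rep_def product_manifold_def fun_eq_iff)

lemma open_chart_Int_preimage:
  assumes M: "smooth_manifold M" "i \<in> idx M" and N1: "smooth_manifold N1" "j \<in> idx N1"
    and N2: "smooth_manifold N2" "l \<in> idx N2"
    and \<phi>: "smooth_map M N1 \<phi>" and \<psi>: "smooth_map M N2 \<psi>"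
  shows "open (chart M i ` {p \<in> dom M i. \<phi> p \<in> dom N1 j \<and> \<psi> p \<in> dom N2 l})"
proof (rule open_chart_image[OF M])
  have "{p \<in> dom M i. \<phi> p \<in> dom N1 j \<and> \<psi> p \<in> dom N2 l} =
      {p \<in> dom M i. \<phi> p \<in> dom N1 j} \<inter> {p \<in> dom M i. \<psi> p \<in> dom N2 l}"
    by blast
  then show "openin (mtop M) {p \<in> dom M i. \<phi> p \<in> dom N1 j \<and> \<psi> p \<in> dom N2 l}"
    by (simp add: openin_Int openin_chart_preimage[OF M N1 \<phi>] openin_chart_preimage[OF M N2 \<psi>])
qed blast

lemma smooth_map_Pair:
  assumes M: "smooth_manifold M" and N: "smooth_manifold N1" "smooth_manifold N2"
    and \<phi>: "smooth_map M N1 \<phi>" and \<psi>: "smooth_map M N2 \<psi>"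
  shows "smooth_map M (product_manifold N1 N2) (\<lambda>x. (\<phi> x, \<psi> x))"
  unfolding smooth_map_def
proof (intro conjI ballI)
  show "continuous_map (mtop M) (mtop (product_manifold N1 N2)) (\<lambda>x. (\<phi> x, \<psi> x))"
    using \<phi> \<psi> by (simp add: smooth_map_def continuous_map_pairedI)
  fix i jl assume i: "i \<in> idx M" and jl: "jl \<in> idx (product_manifold N1 N2)"
  obtain j l where jl_eq: "jl = (j, l)" and j: "j \<in> idx N1" and l: "l \<in> idx N2"
    using jl by auto
  define A where "A = {p \<in> dom M i. \<phi> p \<in> dom N1 j \<and> \<psi> p \<in> dom N2 l}"
  have "open (chart M i ` A)"
    unfolding A_def by (rule open_chart_Int_preimage[OF M i N(1) j N(2) l \<phi> \<psi>])
  moreover have "smooth_on (chart M i ` A) (local_rep M N1 \<phi> i j)"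
    by (rule smooth_on_subset[of "chart M i ` {p \<in> dom M i. \<phi> p \<in> dom N1 j}"])
      (use \<phi> i j in \<open>auto simp: smooth_map_def A_def\<close>)
  moreover have "smooth_on (chart M i ` A) (local_rep M N2 \<psi> i l)"
    by (rule smooth_on_subset[of "chart M i ` {p \<in> dom M i. \<psi> p \<in> dom N2 l}"])
      (use \<psi> i l in \<open>auto simp: smooth_map_def A_def\<close>)
  ultimately show "smooth_on (chart M i ` {p \<in> dom M i. (\<phi> p, \<psi> p) \<in> dom (product_manifold N1 N2) jl})
      (local_rep M (product_manifold N1 N2) (\<lambda>x. (\<phi> x, \<psi> x)) i jl)"
    by (simp add: jl_eq local_rep_product_manifold smooth_on_Pair A_def)
qed

lemma k_tension_product_manifold:
  assumes M: "riemannian_manifold M" "i \<in> idx M" and N1: "riemannian_manifold N1" "j \<in> idx N1"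
    and N2: "riemannian_manifold N2" "l \<in> idx N2"
    and \<phi>: "smooth_map M N1 \<phi>" and \<psi>: "smooth_map M N2 \<psi>"
    and p: "p \<in> dom M i" "\<phi> p \<in> dom N1 j" "\<psi> p \<in> dom N2 l"
    and V: "open V" "chart M i p \<in> V" and e: "orthonormal_frame_on (metric M i) V e"
  shows "k_tension k (metric M i) (metric (product_manifold N1 N2) (j, l)) e
      (local_rep M (product_manifold N1 N2) (\<lambda>x. (\<phi> x, \<psi> x)) i (j, l)) (chart M i p) =
    (k_tension k (metric M i) (metric N1 j) e (local_rep M N1 \<phi> i j) (chart M i p),
     k_tension k (metric M i) (metric N2 l) e (local_rep M N2 \<psi> i l) (chart M i p))"
proof -
  have sm: "smooth_manifold M" "smooth_manifold N1" "smooth_manifold N2"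
    using M N1 N2 by (simp_all add: riemannian_manifold_def)
  define A where "A = {p \<in> dom M i. \<phi> p \<in> dom N1 j \<and> \<psi> p \<in> dom N2 l}"
  \<comment> \<open>On this part of \<open>V\<close> both local representatives take values in their
    chosen charts.\<close>
  define W where "W = V \<inter> chart M i ` A"
  have "open (chart M i ` A)"
    unfolding A_def by (rule open_chart_Int_preimage[OF sm(1) M(2) sm(2) N1(2) sm(3) N2(2) \<phi> \<psi>])
  then have W: "open W"
    unfolding W_def by (rule open_Int[OF V(1)])
  interpret product_chart_map W "metric M i" e
    "chart N1 j ` dom N1 j" "metric N1 j" "local_rep M N1 \<phi> i j"
    "chart N2 l ` dom N2 l" "metric N2 l" "local_rep M N2 \<psi> i l"
    unfolding product_chart_map_def
    by (intro conjI chart_map_local_rep[OF M N1 \<phi> e W] chart_map_local_rep[OF M N2 \<psi> e W])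
      (auto simp: W_def A_def)
  have "chart M i p \<in> W"
    using p V by (auto simp: W_def A_def)
  then show ?thesis
    by (simp add: local_rep_product_manifold k_tension_Pair)
qed

lemma k_harmonic_product_iff:
  assumes M: "riemannian_manifold M" and N1: "riemannian_manifold N1" and N2: "riemannian_manifold N2"
    and \<phi>: "smooth_map M N1 \<phi>" and \<psi>: "smooth_map M N2 \<psi>"
  shows "k_harmonic k M (product_manifold N1 N2) (\<lambda>x. (\<phi> x, \<psi> x)) \<longleftrightarrow>
    k_harmonic k M N1 \<phi> \<and> k_harmonic k M N2 \<psi>"
proof -
  have sm: "smooth_manifold M" "smooth_manifold N1" "smooth_manifold N2"
    using M N1 N2 by (simp_all add: riemannian_manifold_def)
  note T = k_tension_product_manifold[OF M _ N1 _ N2 _ \<phi> \<psi>]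
  show ?thesis
  proof (intro iffI conjI)
    assume P: "k_harmonic k M (product_manifold N1 N2) (\<lambda>x. (\<phi> x, \<psi> x))"
    have *: "k_tension k (metric M i) (metric N1 j) e (local_rep M N1 \<phi> i j) (chart M i p) = 0 \<and>
        k_tension k (metric M i) (metric N2 l) e (local_rep M N2 \<psi> i l) (chart M i p) = 0"
      if p: "p \<in> topspace (mtop M)" and i: "i \<in> idx M" and j: "j \<in> idx N1" and l: "l \<in> idx N2"
        and pd: "p \<in> dom M i" "\<phi> p \<in> dom N1 j" "\<psi> p \<in> dom N2 l"
        and V: "open V" "chart M i p \<in> V" "V \<subseteq> chart M i ` dom M i"
        and e: "orthonormal_frame_on (metric M i) V e"
      for p i j l V e
    proof -
      have "k_tension k (metric M i) (metric (product_manifold N1 N2) (j, l)) e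
          (local_rep M (product_manifold N1 N2) (\<lambda>x. (\<phi> x, \<psi> x)) i (j, l)) (chart M i p) = 0"
        using j l pd by (intro k_harmonicD[OF P p i _ _ _ V e]) simp_all
      then show ?thesis
        using T[OF i j l pd V(1,2) e] by (simp only: prod_eq_iff fst_conv snd_conv fst_zero snd_zero)
    qed
    \<comment> \<open>The fact \<open>*\<close> tests both components in a product chart. To test
      one map alone, a chart of the other target around the image of \<open>p\<close> has to be
      supplied; it exists because the atlas covers the space.\<close>
    have dom1: "\<exists>j\<in>idx N1. \<phi> p \<in> dom N1 j" if "p \<in> topspace (mtop M)" for p
    proof -
      have "\<phi> p \<in> topspace (mtop N1)"
        using that \<phi> continuous_map_image_subset_topspace unfolding smooth_map_def by blast
      then show ?thesis
        using sm(2) by (simp add: smooth_manifold_def)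
    qed
    have dom2: "\<exists>l\<in>idx N2. \<psi> p \<in> dom N2 l" if "p \<in> topspace (mtop M)" for p
    proof -
      have "\<psi> p \<in> topspace (mtop N2)"
        using that \<psi> continuous_map_image_subset_topspace unfolding smooth_map_def by blast
      then show ?thesis
        using sm(3) by (simp add: smooth_manifold_def)
    qed
    show "k_harmonic k M N1 \<phi>"
      by (rule k_harmonicI[OF \<phi>]) (use * dom2 in blast)
    show "k_harmonic k M N2 \<psi>"
      by (rule k_harmonicI[OF \<psi>]) (use * dom1 in blast)
  next
    assume H: "k_harmonic k M N1 \<phi> \<and> k_harmonic k M N2 \<psi>"
    show "k_harmonic k M (product_manifold N1 N2) (\<lambda>x. (\<phi> x, \<psi> x))"
    proof (rule k_harmonicI)
      show "smooth_map M (product_manifold N1 N2) (\<lambda>x. (\<phi> x, \<psi> x))"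
        by (rule smooth_map_Pair[OF sm \<phi> \<psi>])
      fix p i jl V e
      assume p: "p \<in> topspace (mtop M)" "p \<in> dom M i" "(\<phi> p, \<psi> p) \<in> dom (product_manifold N1 N2) jl"
        and i: "i \<in> idx M" and jl: "jl \<in> idx (product_manifold N1 N2)"
        and V: "open V" "chart M i p \<in> V" "V \<subseteq> chart M i ` dom M i"
        and e: "orthonormal_frame_on (metric M i) V e"
      obtain j l where jl_eq: "jl = (j, l)" and j: "j \<in> idx N1" and l: "l \<in> idx N2"
        using jl by auto
      have pd: "\<phi> p \<in> dom N1 j" "\<psi> p \<in> dom N2 l"
        using p(3) by (simp_all add: jl_eq)
      show "k_tension k (metric M i) (metric (product_manifold N1 N2) jl) e
          (local_rep M (product_manifold N1 N2) (\<lambda>x. (\<phi> x, \<psi> x)) i jl) (chart M i p) = 0"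
        unfolding jl_eq T[OF i j l p(2) pd V(1,2) e]
          k_harmonicD[OF H[THEN conjunct1] p(1) i j p(2) pd(1) V e]
          k_harmonicD[OF H[THEN conjunct2] p(1) i l p(2) pd(2) V e]
        by (simp add: zero_prod_def)
    qed
  qed
qed

text \<open>The equivalence is used twice. At order \<open>k\<close>, the harmonic component counts
  as \<open>k\<close>-harmonic, so the pair is \<open>k\<close>-harmonic; at order 1, a harmonic
  pair would make the proper component harmonic.\<close>

theorem theorem6p2:
  fixes k :: nat
    and M :: "('a, 'i, 'm::euclidean_space) rmanifold"
    and N1 :: "('b, 'j, 'n1::euclidean_space) rmanifold"
    and N2 :: "('c, 'l, 'n2::euclidean_space) rmanifold"
    and \<phi> :: "'a \<Rightarrow> 'b" and \<psi> :: "'a \<Rightarrow> 'c"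
  assumes "k \<ge> 1"
    and "riemannian_manifold M" and "riemannian_manifold N1" and "riemannian_manifold N2"
    and "smooth_map M N1 \<phi>" and "smooth_map M N2 \<psi>"
  shows "(k_harmonic k M (product_manifold N1 N2) (\<lambda>x. (\<phi> x, \<psi> x)) \<longleftrightarrow>
            k_harmonic k M N1 \<phi> \<and> k_harmonic k M N2 \<psi>) \<and>
         ((harmonic M N1 \<phi> \<and> proper_k_harmonic k M N2 \<psi>) \<or>
          (proper_k_harmonic k M N1 \<phi> \<and> harmonic M N2 \<psi>) \<longrightarrow>
            proper_k_harmonic k M (product_manifold N1 N2) (\<lambda>x. (\<phi> x, \<psi> x)))"
  using k_harmonic_product_iff[OF assms(2-6)] harmonic_imp_k_harmonic[OF assms(2,3)]
    harmonic_imp_k_harmonic[OF assms(2,4)]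
  unfolding proper_k_harmonic_def by blast

end
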